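(* Let $(X_k)_{k\ge1}$ be a sequence of independent centered square-integrable random variables having non-vanishing continuous densities. Then for every $n\ge1$ the sum $Z_n:=\sum_{k=1}^nX_k$ satisfies $$d_W(Z_n,\mathcal N)\le|1-\mathbb E[Z_n^2]|+\sqrt{\sum_{k=1}^n\Big(\mathbb E\big[(\varphi_{X_k}(X_k))^2\big]-(\mathbb E[X_k^2])^2\Big)},$$ and $$d_{TV}(Z_n,\mathcal N)\le2\,|1-\mathbb E[Z_n^2]|+2\sqrt{\sum_{k=1}^n\Big(\mathbb E\big[(\varphi_{X_k}(X_k))^2\big]-(\mathbb E[X_k^2])^2\Big)}.$$
   Context: $F_k$ denotes the cumulative distribution function of $X_k$. "Non-vanishing continuous density" means that the support of $X_k$ is a (possibly unbounded) interval, in the interior of which the density $F_k'$ is continuous and does not vanish. The Stein kernel of $X_k$ is $$\varphi_{X_k}(y)=-\frac1{F_k'(y)}\int_{-\infty}^yx\,dF_k(x)$$ for $y$ in the interior of the support of $X_k$. $\mathcal N$ is a standard normal random variable; $d_W(X,Y)=\sup_h|\mathbb E[h(X)]-\mathbb E[h(Y)]|$ over Lipschitz $h:\mathbb R\to\mathbb R$ with constant at most $1$; $d_{TV}(X,Y)=\sup_A|\mathbb P(X\in A)-\mathbb P(Y\in A)|$ over Borel sets $A\subset\mathbb R$. The right-hand sides may be $+\infty$. *)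

theory Defs
  imports "HOL-Probability.Probability"
begin

text \<open>A real random variable on a probability space \<open>M\<close> is a function \<open>X :: 'a \<Rightarrow> real\<close>; its law is
  \<^term>\<open>distr M borel X\<close>.\<close>

text \<open>The (topological) support: the smallest closed set carrying the law of \<open>X\<close>.\<close>

definition rv_support :: "'a measure \<Rightarrow> ('a \<Rightarrow> real) \<Rightarrow> real set" where
  "rv_support M X =
     {x. \<forall>U. open U \<longrightarrow> x \<in> U \<longrightarrow> measure (distr M borel X) U > 0}"

definition rv_cdf :: "'a measure \<Rightarrow> ('a \<Rightarrow> real) \<Rightarrow> real \<Rightarrow> real" where
  "rv_cdf M X = cdf (distr M borel X)"

text \<open>The first conjunct says that the law has a Lebesgue density at all; it rules out atoms at the
  end points of the support (and hence also degenerate supports). The density is then the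
  derivative of the distribution function on the interior of the support.\<close>

definition nonvanishing_continuous_density :: "'a measure \<Rightarrow> ('a \<Rightarrow> real) \<Rightarrow> bool" where
  "nonvanishing_continuous_density M X \<longleftrightarrow>
     (\<exists>f. distributed M lborel X f) \<and>
     is_interval (rv_support M X) \<and>
     (\<forall>y\<in>interior (rv_support M X). rv_cdf M X differentiable (at y)) \<and>
     continuous_on (interior (rv_support M X)) (deriv (rv_cdf M X)) \<and>
     (\<forall>y\<in>interior (rv_support M X). deriv (rv_cdf M X) y \<noteq> 0)"

text \<open>The Stein kernel is only meaningful on the interior of the support; the value \<open>0\<close> elsewhere is
  a convention, and is attained by \<open>X\<close> outside the interior with probability zero only.
  Integration against \<open>dF\<close> is integration against the law of \<open>X\<close>.\<close>

definition stein_kernel :: "'a measure \<Rightarrow> ('a \<Rightarrow> real) \<Rightarrow> real \<Rightarrow> real" where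
  "stein_kernel M X y =
     (if y \<in> interior (rv_support M X)
      then - (1 / deriv (rv_cdf M X) y) * (LINT x:{..y}|distr M borel X. x)
      else 0)"

text \<open>The two random variables may live on different probability spaces. The suprema are taken in
  the extended reals, so that an unbounded supremum is \<open>\<infinity>\<close>.\<close>

definition wasserstein_dist ::
  "'a measure \<Rightarrow> ('a \<Rightarrow> real) \<Rightarrow> 'b measure \<Rightarrow> ('b \<Rightarrow> real) \<Rightarrow> ereal" where
  "wasserstein_dist M X N Y =
     (SUP h \<in> {h :: real \<Rightarrow> real. 1-lipschitz_on UNIV h}.
        ereal \<bar>(LINT \<omega>|M. h (X \<omega>)) - (LINT \<omega>|N. h (Y \<omega>))\<bar>)"

definition total_variation_dist ::
  "'a measure \<Rightarrow> ('a \<Rightarrow> real) \<Rightarrow> 'b measure \<Rightarrow> ('b \<Rightarrow> real) \<Rightarrow> ereal" where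
  "total_variation_dist M X N Y =
     (SUP A \<in> sets (borel :: real measure).
        ereal \<bar>measure M {\<omega> \<in> space M. X \<omega> \<in> A} - measure N {\<omega> \<in> space N. Y \<omega> \<in> A}\<bar>)"

text \<open>Square root on the extended reals, meant for nonnegative arguments.\<close>

definition ereal_sqrt :: "ereal \<Rightarrow> ereal" where
  "ereal_sqrt x = (case x of ereal r \<Rightarrow> ereal (sqrt r) | PInfty \<Rightarrow> \<infinity> | MInfty \<Rightarrow> -\<infinity>)"

text \<open>\<open>E[Y\<^sup>2]\<close> as an element of \<open>[0, \<infinity>]\<close>, for \<open>Y\<close> not necessarily square-integrable.\<close>

definition second_moment :: "'a measure \<Rightarrow> ('a \<Rightarrow> real) \<Rightarrow> ereal" where
  "second_moment M Y = enn2ereal (\<integral>\<^sup>+ \<omega>. ennreal ((Y \<omega>)\<^sup>2) \<partial>M)"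

end

theory Submission
  imports Defs
begin

text \<open>The proof is Stein's method. Writing \<open>dF = F' dy\<close> on the interior of the support, Fubini's theorem
  turns \<open>E[X G(X)]\<close> into \<open>E[\<phi>(X) G'(X)]\<close>, and conditioning on the other summands gives
  \<open>E[Z G(Z)] = E[S G'(Z)]\<close> with \<open>S = \<Sum>\<^sub>k \<phi>\<^sub>k(X\<^sub>k)\<close>. For the solution \<open>G\<close> of the Stein equation
  \<open>G'(x) - x G(x) = h(x) - E[h(\<N>)]\<close> this yields
  \<open>\<bar>E[h(Z)] - E[h(\<N>)]\<bar> = \<bar>E[(1 - S) G'(Z)]\<bar> \<le> sup \<bar>G'\<bar> (\<bar>1 - E[S]\<bar> + sd S)\<close>, where \<open>E[S] = E[Z\<^sup>2]\<close> and
  \<open>S\<close> is a sum of independent terms. Here \<open>\<bar>G'\<bar> \<le> 1\<close> if \<open>h\<close> is 1-Lipschitz and \<open>\<bar>G'\<bar> \<le> 2\<close> if \<open>h\<close> is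
  continuous with values in \<open>[0, 1]\<close>; indicators of Borel sets are reached by outer regularity.\<close>

section \<open>Laws with a non-vanishing continuous density\<close>

text \<open>The Stein kernel divides by a density and is a mere convention off the interior of the
  support, so it is never estimated pointwise. What passes through Fubini is its numerator, written
  as the mean of a nonnegative kernel with integral \<open>x^2\<close> in \<open>y\<close>. Square
  integrability of the summands then suffices, together with a bound on \<open>G'\<close>; no bound
  on \<open>G\<close> is ever used. The constants come from tail inequalities for the normal density
  on \<open>{x..}\<close> with \<open>x \<ge> 0\<close>. If \<open>h\<close> has values in
  \<open>[0, 1]\<close>, then \<open>h - E[h(\<N>)]\<close> is bounded by 1 and each of the two
  terms of \<open>G'\<close> contributes at most 1. If \<open>h\<close> is 1-Lipschitz, the same
  split would involve an unbounded function; the constant 1 rests on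
  \<open>\<bar>h x - E[h(\<N>)]\<bar> \<le> sqrt (1 + x^2)\<close> and on a matching sharp
  inequality for \<open>\<psi> x - x * normal_tail x\<close>. The Stein identity is proved for
  continuous \<open>G'\<close>, which forces \<open>h\<close> to be continuous; this is why total
  variation needs the detour through continuous test functions.\<close>

lemma emeasure_outside_support:
  fixes D :: "'a::second_countable_topology measure"
  assumes "finite_measure D" and sets: "sets D = sets borel"
  shows "- {x. \<forall>U. open U \<longrightarrow> x \<in> U \<longrightarrow> measure D U > 0} \<in> null_sets D"
proof -
  interpret finite_measure D by fact
  \<comment> \<open>The complement of the support is the union of all open null sets; second
    countability (Lindelof) reduces this to a countable union.\<close>
  define \<F> where "\<F> = {U::'a set. open U \<and> measure D U = 0}"
  have "\<And>S. S \<in> \<F> \<Longrightarrow> open S" by (simp add: \<F>_def)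
  then obtain \<F>' where \<F>': "\<F>' \<subseteq> \<F>" "countable \<F>'" "\<Union>\<F>' = \<Union>\<F>"
    using Lindelof by metis
  have "- {x. \<forall>U. open U \<longrightarrow> x \<in> U \<longrightarrow> measure D U > 0} = \<Union>\<F>"
    using measure_nonneg[of D] by (force simp: \<F>_def order_less_le)
  also have "\<dots> = (\<Union>U\<in>\<F>'. U)" using \<F>' by simp
  also have "\<dots> \<in> null_sets D"
    using \<F>' by (intro null_sets_UN') (auto simp: \<F>_def sets emeasure_eq_measure null_sets_def)
  finally show ?thesis .
qed

lemma open_interval_eq_einterval:
  fixes J :: "real set"
  assumes "open J" "is_interval J"
  shows "J = einterval (INF x\<in>J. ereal x) (SUP x\<in>J. ereal x)"
proof (intro set_eqI iffI)
  fix x assume x: "x \<in> J"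
  then obtain e where e: "e > 0" "cball x e \<subseteq> J"
    using \<open>open J\<close> open_contains_cball by blast
  have "x - e \<in> J" "x + e \<in> J" using e by (auto simp: dist_real_def subset_eq)
  then have "(INF x\<in>J. ereal x) \<le> ereal (x - e)" "ereal (x + e) \<le> (SUP x\<in>J. ereal x)"
    by (auto intro: INF_lower SUP_upper)
  moreover have "ereal (x - e) < ereal x" "ereal x < ereal (x + e)" using e by auto
  ultimately show "x \<in> einterval (INF x\<in>J. ereal x) (SUP x\<in>J. ereal x)"
    unfolding einterval_def by (metis (mono_tags, lifting) le_less_trans less_le_trans mem_Collect_eq)
next
  fix x assume "x \<in> einterval (INF x\<in>J. ereal x) (SUP x\<in>J. ereal x)"
  then have "(INF x\<in>J. ereal x) < ereal x" "ereal x < (SUP x\<in>J. ereal x)"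
    by (auto simp: einterval_def)
  then obtain a b where "a \<in> J" "b \<in> J" "a < x" "x < b"
    by (auto simp: INF_less_iff less_SUP_iff)
  then show "x \<in> J" using assms(2) by (meson is_interval_1 less_imp_le)
qed

text \<open>The fundamental theorem of calculus gives masses only for compact intervals inside
  \<open>J\<close>, where the distribution function is differentiable. An increasing exhaustion by
  such intervals and continuity from below carry the equality to \<open>J\<close>.\<close>

lemma emeasure_open_interval_eqI:
  fixes D E :: "real measure"
  assumes "sets D = sets borel" "sets E = sets borel" "open J" "is_interval J"
    and Icc: "\<And>a b. a \<le> b \<Longrightarrow> {a..b} \<subseteq> J \<Longrightarrow> emeasure D {a..b} = emeasure E {a..b}"
  shows "emeasure D J = emeasure E J"
proof (cases "J = {}")
  case False
  let ?a = "INF x\<in>J. ereal x" and ?b = "SUP x\<in>J. ereal x"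
  have J: "J = einterval ?a ?b" using assms by (intro open_interval_eq_einterval)
  with False have "?a < ?b" by (force simp: einterval_def)
  then obtain u l where ul: "einterval ?a ?b = (\<Union>i. {l i .. u i})" "incseq u" "decseq l"
     "\<And>i. l i < u i" by (rule einterval_Icc_approximation) blast
  have inc: "incseq (\<lambda>i. {l i .. u i})"
    using ul by (auto simp: incseq_def decseq_def intro: order_trans)
  have J': "J = (\<Union>i. {l i .. u i})" using J ul(1) by simp
  have eq: "emeasure D {l i..u i} = emeasure E {l i..u i}" for i
    using Icc[of "l i" "u i"] ul(4)[of i] J' by force
  have "emeasure D J = (SUP i. emeasure D {l i .. u i})" unfolding J'
    by (intro SUP_emeasure_incseq[symmetric] inc) (auto simp: assms)
  also have "\<dots> = (SUP i. emeasure E {l i .. u i})" unfolding eq ..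
  also have "\<dots> = emeasure E J" unfolding J'
    by (intro SUP_emeasure_incseq inc) (auto simp: assms)
  finally show ?thesis .
qed simp

lemma interior_interval_complement:
  fixes I :: "real set"
  assumes "is_interval I" "y \<notin> interior I"
  shows "interior I \<subseteq> {..<y} \<or> interior I \<subseteq> {y<..}"
proof -
  have *: "is_interval (interior I)"
    using assms(1) by (simp add: is_interval_convex_1 convex_interior)
  have "x < y" if "a \<in> interior I" "a < y" "x \<in> interior I" for a x
    using * assms(2) that unfolding is_interval_1 by (meson less_imp_le not_less)
  moreover have "y \<notin> interior I" by fact
  ultimately show ?thesis by (metis greaterThan_iff lessThan_iff linorder_cases subsetI)
qed

locale continuous_density_rv = prob_space M for M :: "'a measure" +
  fixes X :: "'a \<Rightarrow> real"
  assumes ncd: "nonvanishing_continuous_density M X"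
begin

abbreviation "D \<equiv> distr M borel X"
abbreviation "I \<equiv> interior (rv_support M X)"
abbreviation "f \<equiv> deriv (rv_cdf M X)"

lemma rv[measurable]: "X \<in> borel_measurable M"
proof -
  obtain g where "distributed M lborel X g"
    using ncd by (auto simp: nonvanishing_continuous_density_def)
  then show ?thesis by (auto dest: distributed_measurable)
qed

sublocale D: real_distribution D
  by (intro real_distribution_distr) simp

lemma interval: "is_interval (rv_support M X)"
  using ncd by (simp add: nonvanishing_continuous_density_def)

lemma interval_I: "is_interval I"
  using interval by (simp add: is_interval_convex_1 convex_interior)

lemma DERIV_cdf: "y \<in> I \<Longrightarrow> DERIV (cdf D) y :> f y"
  using ncd by (simp add: nonvanishing_continuous_density_def rv_cdf_def DERIV_deriv_iff_real_differentiable)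

lemma f_pos: "y \<in> I \<Longrightarrow> f y > 0"
proof -
  assume y: "y \<in> I"
  have "f y \<ge> 0"
    by (rule mono_on_imp_deriv_nonneg[OF _ DERIV_cdf[OF y]])
      (use y in \<open>auto intro: mono_onI D.cdf_nondecreasing\<close>)
  moreover have "f y \<noteq> 0" using y ncd by (simp add: nonvanishing_continuous_density_def)
  ultimately show ?thesis by simp
qed

lemma f_measurable[measurable]: "(\<lambda>y. f y * indicator I y) \<in> borel_measurable borel"
proof -
  have "(\<lambda>y. indicator I y *\<^sub>R f y) \<in> borel_measurable borel"
    using ncd by (intro borel_measurable_continuous_on_indicator)
      (auto simp: nonvanishing_continuous_density_def)
  then show ?thesis by (simp add: mult.commute)
qed

lemma null_sets_law: "A \<in> null_sets lborel \<Longrightarrow> A \<in> null_sets D"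
proof -
  assume A: "A \<in> null_sets lborel"
  obtain g where g: "distributed M lborel X g"
    using ncd by (auto simp: nonvanishing_continuous_density_def)
  have "D = density lborel g"
    using g by (simp add: distributed_def cong: distr_cong)
  moreover have "g \<in> borel_measurable lborel" using g by (auto simp: distributed_def)
  ultimately show ?thesis
    using A absolutely_continuousI_density[of g lborel] by (auto simp: absolutely_continuous_def)
qed

text \<open>The frontier of a convex set is Lebesgue negligible, so absolute continuity of the law
  removes the end points of the support.\<close>

lemma null_outside_I: "- I \<in> null_sets D"
proof -
  have "- rv_support M X \<in> null_sets D"
    unfolding rv_support_def by (intro emeasure_outside_support D.finite_measure_axioms) simp
  moreover have "frontier (rv_support M X) \<in> null_sets D"
  proof (rule null_sets_law)
    have "negligible (frontier (rv_support M X))"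
      using interval by (intro negligible_convex_frontier) (simp add: is_interval_convex_1)
    then show "frontier (rv_support M X) \<in> null_sets lborel"
      by (auto simp: negligible_iff_null_sets null_sets_completion_iff)
  qed
  ultimately have "- rv_support M X \<union> frontier (rv_support M X) \<in> null_sets D" by auto
  moreover have "- I \<subseteq> - rv_support M X \<union> frontier (rv_support M X)"
    using closure_subset by (auto simp: frontier_def)
  ultimately show ?thesis by (intro null_sets_subset[where A="- I"]) auto
qed

text \<open>The hypothesis supplies some density; this identifies it with the derivative of the
  distribution function, the one in the Stein kernel. Half-lines determine the law, and their parts
  in \<open>I\<close> are open intervals.\<close>

lemma distr_eq_density: "D = density lborel (\<lambda>y. ennreal (f y * indicator I y))"
  (is "_ = ?E")
proof (rule measure_eqI_lessThan)
  fix y :: real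
  have eq: "emeasure D (I \<inter> {y<..}) = emeasure ?E (I \<inter> {y<..})"
  proof (rule emeasure_open_interval_eqI)
    show "is_interval (I \<inter> {y<..})" using interval_I by (intro is_interval_Int is_interval_oi)
    fix a b :: real assume ab: "a \<le> b" "{a..b} \<subseteq> I \<inter> {y<..}"
    have "emeasure ?E {a..b} = (\<integral>\<^sup>+x. ennreal (f x * indicator I x) * indicator {a..b} x \<partial>lborel)"
      by (subst emeasure_density) auto
    also have "\<dots> = cdf D b - cdf D a"
      using ab by (intro nn_integral_FTC_Icc) (auto simp: subset_eq less_imp_le[OF f_pos] DERIV_cdf)
    also have "\<dots> = ennreal (measure D {a..b})"
    proof -
      \<comment> \<open>A difference of values of \<open>cdf\<close> measures
        \<open>{a<..b}\<close>, so the left end point has to carry no mass.\<close>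
      have a: "{a} \<in> null_sets D" by (intro null_sets_law) auto
      have "measure D {a..b} = measure D ({a<..b} \<union> {a})"
        using ab by (intro arg_cong[where f="measure D"]) auto
      also have "\<dots> = measure D {a<..b}"
        by (rule measure_Un_null_set[OF _ a]) auto
      also have "\<dots> = cdf D b - cdf D a"
        using D.cdf_diff_eq[of a b] ab by (cases "a = b") auto
      finally show ?thesis by simp
    qed
    also have "\<dots> = emeasure D {a..b}" by (simp add: D.emeasure_eq_measure)
    finally show "emeasure D {a..b} = emeasure ?E {a..b}" ..
  qed auto
  have "emeasure D {y<..} = emeasure D ((I \<inter> {y<..}) \<union> (-I \<inter> {y<..}))"
    by (intro arg_cong[where f="emeasure D"]) auto
  also have "\<dots> = emeasure D (I \<inter> {y<..})"
    by (intro emeasure_Un_null_set null_set_Int2 null_outside_I) auto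
  also have "\<dots> = emeasure ?E {y<..}"
    unfolding eq by (subst (1 2) emeasure_density, (measurable, auto)+) (auto intro!: nn_integral_cong split: split_indicator)
  finally show "emeasure D {y<..} = emeasure ?E {y<..}" .
qed (auto simp: D.emeasure_eq_measure)

end

section \<open>The Stein identity\<close>

text \<open>Averaging this kernel over the law of a centered \<open>X\<close> gives the numerator of the Stein kernel at \<open>y\<close>,
  while integrating it in \<open>y\<close> against \<open>G'\<close> gives \<open>x (G x - G 0)\<close>.\<close>

definition tail_kernel :: "real \<Rightarrow> real \<Rightarrow> real" where
  "tail_kernel x y = \<bar>x\<bar> * of_bool (0 \<le> y \<and> y < x \<or> x \<le> y \<and> y < 0)"

lemma integral_tail_kernel:
  assumes G: "\<And>y. DERIV G y :> u y" and u: "continuous_on UNIV u"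
  shows "integrable lborel (\<lambda>y. tail_kernel x y * u y)"
    and "(LBINT y. tail_kernel x y * u y) = x * (G x - G 0)"
proof -
  have [measurable]: "u \<in> borel_measurable borel"
    using u by (rule borel_measurable_continuous_onI)
  have [measurable]: "tail_kernel x \<in> borel_measurable borel"
    unfolding tail_kernel_def by measurable
  have FTC: "has_bochner_integral lborel (\<lambda>y. indicator {a..b} y *\<^sub>R u y) (G b - G a)" if "a \<le> b" for a b
    using that G u by (intro has_bochner_integral_FTC_Icc)
     (auto intro: has_field_derivative_at_within continuous_on_subset simp flip: has_real_derivative_iff_has_vector_derivative)
  have "has_bochner_integral lborel (\<lambda>y. tail_kernel x y * u y) (x * (G x - G 0))"
  proof (cases "0 \<le> x")
    case True
    have "AE y in lborel. tail_kernel x y * u y = x * (indicator {0..x} y *\<^sub>R u y)"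
      using AE_lborel_singleton[of x] AE_lborel_singleton[of 0]
      by eventually_elim (use True in \<open>auto simp: tail_kernel_def split: split_indicator\<close>)
    then show ?thesis
      using has_bochner_integral_mult_right[OF FTC[OF True], of x]
      by (subst has_bochner_integral_cong_AE) auto
  next
    case False
    then have "x \<le> 0" by simp
    \<comment> \<open>For negative \<open>x\<close> the kernel is \<open>-x\<close> between
      \<open>x\<close> and 0, and \<open>-x * (G 0 - G x)\<close> is again
      \<open>x * (G x - G 0)\<close>.\<close>
    have "AE y in lborel. tail_kernel x y * u y = (-x) * (indicator {x..0} y *\<^sub>R u y)"
      using AE_lborel_singleton[of x] AE_lborel_singleton[of 0]
      by eventually_elim (use False in \<open>auto simp: tail_kernel_def split: split_indicator\<close>)
    then show ?thesis
      using has_bochner_integral_mult_right[OF FTC[OF \<open>x \<le> 0\<close>], of "-x"]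
      by (subst has_bochner_integral_cong_AE) (auto simp: algebra_simps)
  qed
  then show "integrable lborel (\<lambda>y. tail_kernel x y * u y)"
    "(LBINT y. tail_kernel x y * u y) = x * (G x - G 0)"
    by (auto simp: has_bochner_integral_iff)
qed

locale centered_density_rv = continuous_density_rv +
  assumes sq: "integrable M (\<lambda>\<omega>. (X \<omega>)\<^sup>2)"
    and mean: "expectation X = 0"
begin

abbreviation "\<phi> \<equiv> stein_kernel M X"

lemma integrable_rv: "integrable M X"
  by (rule square_integrable_imp_integrable) (auto simp: sq)

lemma law_moments: "integrable D (\<lambda>x. x)" "integrable D (\<lambda>x. x\<^sup>2)" "(LINT x|D. x) = 0"
  using integrable_rv sq mean by (auto simp: integrable_distr_eq integral_distr)

text \<open>The half-open ranges in \<open>tail_kernel\<close> make this exact for every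
  \<open>y\<close>. For \<open>y < 0\<close> the kernel is the lower tail of \<open>-x\<close>; for
  \<open>y \<ge> 0\<close> it is the upper tail of \<open>x\<close>, and \<open>E[X] = 0\<close>
  exchanges the two.\<close>

lemma tail_eq: "- (LINT x:{..y}|D. x) = (LINT x|D. tail_kernel x y)"
proof (cases "y < 0")
  case True
  then have "(LINT x|D. tail_kernel x y) = (LINT x|D. - (indicator {..y} x *\<^sub>R x))"
    by (intro Bochner_Integration.integral_cong) (auto simp: tail_kernel_def)
  then show ?thesis by (simp add: set_lebesgue_integral_def)
next
  case False
  have i: "integrable D (\<lambda>x. indicator {..y} x *\<^sub>R x)"
    using law_moments(1) by (intro integrable_mult_indicator) auto
  have "(LINT x|D. tail_kernel x y) = (LINT x|D. x - indicator {..y} x *\<^sub>R x)"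
    using False by (intro Bochner_Integration.integral_cong) (auto simp: tail_kernel_def)
  also have "\<dots> = - (LINT x|D. indicator {..y} x *\<^sub>R x)"
    using i law_moments by simp
  finally show ?thesis by (simp add: set_lebesgue_integral_def)
qed

text \<open>Off \<open>I\<close> all the mass lies strictly on one side of \<open>y\<close>, so the
  truncated mean is either the full mean 0 or an integral over a null set.\<close>

lemma tail_zero:
  assumes "y \<notin> I"
  shows "(LINT x:{..y}|D. x) = 0"
proof -
  have AE: "AE x in D. x \<in> I" using AE_not_in[OF null_outside_I] by simp
  from interior_interval_complement[OF interval assms]
  consider "I \<subseteq> {..<y}" | "I \<subseteq> {y<..}" by auto
  then show ?thesis
  proof cases
    case 1
    have "(LINT x:{..y}|D. x) = (LINT x|D. x)"
      unfolding set_lebesgue_integral_def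
      by (rule integral_cong_AE, measurable, use AE in eventually_elim) (use 1 in auto)
    then show ?thesis using law_moments by simp
  next
    case 2
    have "(LINT x:{..y}|D. x) = (LINT x|D. 0)"
      unfolding set_lebesgue_integral_def
      by (rule integral_cong_AE, measurable, use AE in eventually_elim) (use 2 in auto)
    then show ?thesis by simp
  qed
qed

text \<open>Multiplying by the density clears the division in the Stein kernel. Off \<open>I\<close>
  both sides vanish, so the identity holds on the whole line and can be integrated against Lebesgue
  measure.\<close>

lemma stein_kernel_density: "(f y * indicator I y) * \<phi> y = (LINT x|D. tail_kernel x y)"
  using f_pos[of y] tail_zero[of y] unfolding tail_eq[symmetric]
  by (auto simp: stein_kernel_def)

lemma stein_kernel_measurable[measurable]: "\<phi> \<in> borel_measurable borel"
proof -
  \<comment> \<open>The derivative of the distribution function is controlled only on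
    \<open>I\<close>, so measurability is read off a formula in the truncated density;
    \<open>inverse 0 = 0\<close> reproduces the value 0 off \<open>I\<close>.\<close>
  have "\<phi> = (\<lambda>y. inverse (f y * indicator I y) * (LINT x|D. tail_kernel x y))"
    unfolding stein_kernel_density[symmetric]
  proof
    fix y
    show "\<phi> y = inverse (f y * indicator I y) * (f y * indicator I y * \<phi> y)"
      using f_pos[of y] by (cases "y \<in> I") (auto simp: stein_kernel_def field_simps)
  qed
  moreover have "(\<lambda>p. tail_kernel (snd p) (fst p)) \<in> borel_measurable (borel \<Otimes>\<^sub>M D)"
    unfolding tail_kernel_def by measurable
  then have [measurable]: "(\<lambda>y. LINT x|D. tail_kernel x y) \<in> borel_measurable borel"
    using D.borel_measurable_lebesgue_integral[of "\<lambda>y x. tail_kernel x y" borel]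
    by (simp add: case_prod_beta')
  ultimately show ?thesis by (simp del: inverse_mult_distrib)
qed

lemma stein_identity:
  assumes G: "\<And>y. DERIV G y :> u y" and u: "continuous_on UNIV u" and B: "\<And>y. \<bar>u y\<bar> \<le> B"
  shows "integrable D (\<lambda>x. \<phi> x * u x)"
    and "(LINT x|D. \<phi> x * u x) = (LINT x|D. x * (G x - G 0))"
proof -
  interpret pair_sigma_finite D lborel ..
  have [measurable]: "u \<in> borel_measurable borel"
    using u by (rule borel_measurable_continuous_onI)
  have ker_m: "(\<lambda>(x, y). tail_kernel x y) \<in> borel_measurable (D \<Otimes>\<^sub>M lborel)"
    unfolding tail_kernel_def by measurable
  note id = integral_tail_kernel[of "\<lambda>x. x" "\<lambda>_. 1", simplified]
  \<comment> \<open>The kernel is nonnegative and its integral in \<open>y\<close> is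
    \<open>x^2\<close> (the case where \<open>G\<close> is the identity), so Tonelli turns the
    second moment of \<open>X\<close> into integrability on the product.\<close>
  have ker: "integrable (D \<Otimes>\<^sub>M lborel) (\<lambda>(x, y). tail_kernel x y)"
  proof (rule Fubini_integrable[OF ker_m])
    have "\<bar>tail_kernel x y\<bar> = tail_kernel x y" for x y by (simp add: tail_kernel_def)
    then show "integrable D (\<lambda>x. LBINT y. norm (case (x, y) of (x, y) \<Rightarrow> tail_kernel x y))"
      using law_moments(2) by (simp add: id power2_eq_square)
  qed (simp add: id)
  have int: "integrable (D \<Otimes>\<^sub>M lborel) (\<lambda>(x, y). tail_kernel x y * u y)"
  proof (rule Bochner_Integration.integrable_bound[OF integrable_mult_right[OF ker, of B]])
    show "(\<lambda>(x, y). tail_kernel x y * u y) \<in> borel_measurable (D \<Otimes>\<^sub>M lborel)"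
      unfolding tail_kernel_def by measurable
    have "\<bar>tail_kernel x y * u y\<bar> \<le> \<bar>B * tail_kernel x y\<bar>" for x y
    proof -
      have "\<bar>tail_kernel x y\<bar> * \<bar>u y\<bar> \<le> \<bar>tail_kernel x y\<bar> * \<bar>B\<bar>"
        using B[of y] by (intro mult_left_mono) auto
      then show ?thesis by (simp add: abs_mult mult.commute)
    qed
    then show "AE p in D \<Otimes>\<^sub>M lborel. norm (case p of (x, y) \<Rightarrow> tail_kernel x y * u y)
       \<le> norm (B * (case p of (x, y) \<Rightarrow> tail_kernel x y))"
      by (auto simp: case_prod_beta')
  qed
  have eq: "(LINT x|D. tail_kernel x y * u y) = (f y * indicator I y) *\<^sub>R (\<phi> y * u y)" for y
    unfolding real_scaleR_def mult.assoc[symmetric] stein_kernel_density by simp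
  have nonneg: "AE y in lborel. 0 \<le> f y * indicator I y"
    using f_pos by (intro AE_I2) (auto split: split_indicator intro: less_imp_le)
  have "integrable lborel (\<lambda>y. LINT x|D. tail_kernel x y * u y)"
    using integrable_snd[OF int] by simp
  then show "integrable D (\<lambda>x. \<phi> x * u x)"
    unfolding eq by (subst distr_eq_density, subst integrable_density) (use nonneg in auto)
  have "(LINT x|D. \<phi> x * u x) = (LINT y|lborel. LINT x|D. tail_kernel x y * u y)"
    unfolding eq by (subst distr_eq_density, subst integral_density) (use nonneg in auto)
  also have "\<dots> = (LINT x|D. LINT y|lborel. tail_kernel x y * u y)"
    by (rule Fubini_integral[OF int])
  also have "\<dots> = (LINT x|D. x * (G x - G 0))"
    by (simp add: integral_tail_kernel(2)[OF G u])
  finally show "(LINT x|D. \<phi> x * u x) = (LINT x|D. x * (G x - G 0))" .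
qed

end

text \<open>For fixed \<open>W = w\<close> this is the Stein identity for the shift of
  \<open>G\<close> by \<open>w\<close>; the constant \<open>G w\<close> drops out because
  \<open>E[X] = 0\<close>. Integrability comes from the split
  \<open>G (X + W) = (G (X + W) - G W) + G W\<close>: times \<open>X\<close>, the first part is at
  most \<open>B * X^2\<close> as \<open>G\<close> is \<open>B\<close>-Lipschitz, and the second is a
  product of independent integrable variables.\<close>

lemma (in centered_density_rv) stein_identity_indep:
  assumes indep: "indep_var borel X borel W" and W: "integrable M W"
    and G: "\<And>y. DERIV G y :> u y" and u: "continuous_on UNIV u" and B: "\<And>y. \<bar>u y\<bar> \<le> B"
  shows "integrable M (\<lambda>\<omega>. X \<omega> * G (X \<omega> + W \<omega>))"
    and "integrable M (\<lambda>\<omega>. \<phi> (X \<omega>) * u (X \<omega> + W \<omega>))"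
    and "expectation (\<lambda>\<omega>. X \<omega> * G (X \<omega> + W \<omega>)) = expectation (\<lambda>\<omega>. \<phi> (X \<omega>) * u (X \<omega> + W \<omega>))"
proof -
  have [measurable]: "W \<in> borel_measurable M" using indep by (rule indep_var_rv2)
  have cG: "continuous_on UNIV G" by (rule DERIV_continuous_on[where D=u]) (simp add: G)
  have [measurable]: "u \<in> borel_measurable borel" "G \<in> borel_measurable borel"
    using u cG by (auto intro: borel_measurable_continuous_onI)
  have lip: "\<bar>G x - G y\<bar> \<le> B * \<bar>x - y\<bar>" for x y
    using field_differentiable_bound[of UNIV G u B x y] G B by simp
  have phi: "integrable D \<phi>"
    using stein_identity(1)[of "\<lambda>x. x" "\<lambda>_. 1" 1] by simp
  let ?DW = "distr M borel W"
  have joint: "distr M (borel \<Otimes>\<^sub>M borel) (\<lambda>\<omega>. (X \<omega>, W \<omega>)) = D \<Otimes>\<^sub>M ?DW"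
    using indep by (simp add: indep_var_distribution_eq)
  interpret DW: prob_space ?DW by (rule prob_space_distr) simp
  interpret pair_sigma_finite D ?DW ..
  have pull: "integrable M (\<lambda>\<omega>. k (X \<omega>) (W \<omega>)) \<longleftrightarrow> integrable (D \<Otimes>\<^sub>M ?DW) (case_prod k)"
       "expectation (\<lambda>\<omega>. k (X \<omega>) (W \<omega>)) = integral\<^sup>L (D \<Otimes>\<^sub>M ?DW) (case_prod k)"
    if [measurable]: "case_prod k \<in> borel_measurable (borel \<Otimes>\<^sub>M borel)" for k :: "real \<Rightarrow> real \<Rightarrow> real"
    unfolding joint[symmetric] by (simp_all add: integrable_distr_eq integral_distr case_prod_beta')
  have "integrable M (\<lambda>\<omega>. \<phi> (X \<omega>))"
    using phi by (simp add: integrable_distr_eq)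
  then have "integrable M (\<lambda>\<omega>. B * \<phi> (X \<omega>))" by simp
  then show i2: "integrable M (\<lambda>\<omega>. \<phi> (X \<omega>) * u (X \<omega> + W \<omega>))"
  proof (rule Bochner_Integration.integrable_bound)
    have "\<bar>\<phi> x * u y\<bar> \<le> \<bar>B * \<phi> x\<bar>" for x y
    proof -
      have "\<bar>\<phi> x\<bar> * \<bar>u y\<bar> \<le> \<bar>\<phi> x\<bar> * \<bar>B\<bar>" using B[of y] by (intro mult_left_mono) auto
      then show ?thesis by (simp add: abs_mult mult.commute)
    qed
    then show "AE \<omega> in M. norm (\<phi> (X \<omega>) * u (X \<omega> + W \<omega>)) \<le> norm (B * \<phi> (X \<omega>))" by simp
  qed simp
  have bnd: "\<bar>x * (G (x + w) - G w)\<bar> \<le> B * x\<^sup>2" for x w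
  proof -
    have "\<bar>x\<bar> * \<bar>G (x + w) - G w\<bar> \<le> \<bar>x\<bar> * (B * \<bar>x\<bar>)"
      using lip[of "x + w" w] by (intro mult_left_mono) auto
    also have "\<bar>x\<bar> * (B * \<bar>x\<bar>) = B * x\<^sup>2"
      by (simp only: mult.left_commute[of _ B] abs_mult_self_eq power2_eq_square)
    finally show ?thesis by (simp add: abs_mult)
  qed
  have "integrable M (\<lambda>\<omega>. X \<omega> * (G (X \<omega> + W \<omega>) - G (W \<omega>)))"
  proof (rule Bochner_Integration.integrable_bound[OF integrable_mult_right[OF sq, of B]])
    show "AE \<omega> in M. norm (X \<omega> * (G (X \<omega> + W \<omega>) - G (W \<omega>))) \<le> norm (B * (X \<omega>)\<^sup>2)"
      unfolding real_norm_def by (intro AE_I2 order_trans[OF bnd abs_ge_self])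
  qed simp
  moreover have "integrable M (\<lambda>\<omega>. X \<omega> * G (W \<omega>))"
  proof (rule indep_var_integrable[OF _ integrable_rv])
    show "indep_var borel X borel (\<lambda>\<omega>. G (W \<omega>))"
      using indep_var_compose[OF indep, of "\<lambda>x. x" borel G borel] by (simp add: comp_def)
    have bG: "\<bar>G w\<bar> \<le> \<bar>G 0\<bar> + B * \<bar>w\<bar>" for w using lip[of w 0] by (simp del: abs_mult)
    show "integrable M (\<lambda>\<omega>. G (W \<omega>))"
    proof (rule Bochner_Integration.integrable_bound)
      show "integrable M (\<lambda>\<omega>. \<bar>G 0\<bar> + B * \<bar>W \<omega>\<bar>)" using W by simp
      show "AE \<omega> in M. norm (G (W \<omega>)) \<le> norm (\<bar>G 0\<bar> + B * \<bar>W \<omega>\<bar>)"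
        unfolding real_norm_def by (intro AE_I2 order_trans[OF bG abs_ge_self])
    qed simp
  qed
  ultimately have "integrable M (\<lambda>\<omega>. X \<omega> * (G (X \<omega> + W \<omega>) - G (W \<omega>)) + X \<omega> * G (W \<omega>))"
    by (rule Bochner_Integration.integrable_add)
  then show i1: "integrable M (\<lambda>\<omega>. X \<omega> * G (X \<omega> + W \<omega>))" by (simp add: algebra_simps)
  have m: "(\<lambda>(x, w). x * G (x + w)) \<in> borel_measurable (borel \<Otimes>\<^sub>M borel)"
    "(\<lambda>(x, w). \<phi> x * u (x + w)) \<in> borel_measurable (borel \<Otimes>\<^sub>M borel)"
    by measurable
  have inner: "(LINT x|D. x * G (x + w)) = (LINT x|D. \<phi> x * u (x + w))" for w
  proof -
    have "integrable D (\<lambda>x. x * (G (x + w) - G w))"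
    proof (rule Bochner_Integration.integrable_bound[OF integrable_mult_right[OF law_moments(2), of B]])
      show "AE x in D. norm (x * (G (x + w) - G w)) \<le> norm (B * x\<^sup>2)"
        unfolding real_norm_def by (intro AE_I2 order_trans[OF bnd abs_ge_self])
    qed simp
    then have "(LINT x|D. x * (G (x + w) - G w) + G w * x) = (LINT x|D. x * (G (x + w) - G w))"
      using law_moments by simp
    moreover have "(LINT x|D. \<phi> x * u (x + w)) = (LINT x|D. x * (G (x + w) - G (0 + w)))"
    proof (rule stein_identity(2)[of "\<lambda>x. G (x + w)" "\<lambda>x. u (x + w)" B])
      show "DERIV (\<lambda>x. G (x + w)) y :> u (y + w)" for y
        using G[of "y + w"] by (simp add: DERIV_shift)
      show "continuous_on UNIV (\<lambda>x. u (x + w))"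
        by (intro continuous_on_compose2[OF u] continuous_intros) auto
    qed (rule B)
    ultimately show ?thesis by (simp add: algebra_simps)
  qed
  have "expectation (\<lambda>\<omega>. X \<omega> * G (X \<omega> + W \<omega>)) = integral\<^sup>L (D \<Otimes>\<^sub>M ?DW) (\<lambda>(x, w). x * G (x + w))"
    by (rule pull(2)[OF m(1)])
  also have "\<dots> = (LINT w|?DW. LINT x|D. x * G (x + w))"
    using i1 pull(1)[OF m(1)] by (intro integral_snd[symmetric]) simp
  also have "\<dots> = (LINT w|?DW. LINT x|D. \<phi> x * u (x + w))" by (simp only: inner)
  also have "\<dots> = integral\<^sup>L (D \<Otimes>\<^sub>M ?DW) (\<lambda>(x, w). \<phi> x * u (x + w))"
    using i2 pull(1)[OF m(2)] by (intro integral_snd) simp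
  also have "\<dots> = expectation (\<lambda>\<omega>. \<phi> (X \<omega>) * u (X \<omega> + W \<omega>))"
    by (rule pull(2)[OF m(2), symmetric])
  finally show "expectation (\<lambda>\<omega>. X \<omega> * G (X \<omega> + W \<omega>)) = expectation (\<lambda>\<omega>. \<phi> (X \<omega>) * u (X \<omega> + W \<omega>))" .
qed

lemma (in centered_density_rv) stein_kernel_integrable: "integrable M (\<lambda>\<omega>. \<phi> (X \<omega>))"
  and stein_kernel_expectation: "expectation (\<lambda>\<omega>. \<phi> (X \<omega>)) = expectation (\<lambda>\<omega>. (X \<omega>)\<^sup>2)"
  using stein_identity[of "\<lambda>x. x" "\<lambda>_. 1" 1]
  by (simp_all add: integrable_distr_eq integral_distr power2_eq_square)

section \<open>The Stein equation for the normal distribution\<close>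

abbreviation "\<psi> \<equiv> std_normal_density"

lemma std_normal_density_pos: "\<psi> x > 0" by (simp add: normal_density_pos)

lemma DERIV_std_normal_density: "DERIV \<psi> x :> - x * \<psi> x"
  unfolding std_normal_density_def
  by (auto intro!: derivative_eq_intros simp: field_simps)

lemma continuous_std_normal_density: "continuous_on A \<psi>"
  unfolding std_normal_density_def[abs_def] by (intro continuous_intros) auto

lemma std_normal_density_at_top: "((\<lambda>x. x ^ k * \<psi> x) \<longlongrightarrow> 0) at_top"
proof (rule tendsto_sandwich[OF _ _ tendsto_const tendsto_power_div_exp_0[of k]])
  have "sqrt 1 \<le> sqrt (2 * pi)" using pi_ge_two by (intro real_sqrt_le_mono) linarith
  then have c: "1 / sqrt (2 * pi) \<le> 1" by simp
  show "\<forall>\<^sub>F x in at_top. x ^ k * \<psi> x \<le> x ^ k / exp x"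
    using eventually_ge_at_top[of 2]
  proof eventually_elim
    case (elim x)
    then have "x * 2 \<le> x * x" by (intro mult_left_mono) auto
    then have "exp (- x\<^sup>2 / 2) \<le> exp (- x)" by (simp add: power2_eq_square)
    then have "\<psi> x \<le> 1 * exp (- x)"
      unfolding std_normal_density_def using c by (intro mult_mono) auto
    then have "x ^ k * \<psi> x \<le> x ^ k * exp (- x)"
      using elim by (intro mult_left_mono) auto
    then show ?case by (simp add: exp_minus field_simps)
  qed
  show "\<forall>\<^sub>F x in at_top. 0 \<le> x ^ k * \<psi> x"
    using eventually_ge_at_top[of 0] by eventually_elim (auto simp: less_imp_le[OF std_normal_density_pos])
qed

section \<open>Integrals over half-lines as functions of their end point\<close>

lemma integral_Icc_eq:
  fixes f F :: "real \<Rightarrow> real"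
  assumes F: "\<And>t. DERIV F t :> f t" and f: "continuous_on UNIV f" and "x \<le> y"
  shows "(LINT t:{x..y}|lborel. f t) = F y - F x"
  unfolding set_lebesgue_integral_def
  by (rule integral_FTC_Icc) (use assms in \<open>auto intro: has_field_derivative_at_within continuous_on_subset
      simp flip: has_real_derivative_iff_has_vector_derivative\<close>)

lemma integral_atLeast_eq:
  fixes f F :: "real \<Rightarrow> real"
  assumes F: "\<And>t. DERIV F t :> f t" and f: "continuous_on UNIV f" and int: "integrable lborel f"
    and lim: "(F \<longlongrightarrow> 0) at_top"
  shows "(LINT t:{x..}|lborel. f t) = - F x"
proof -
  have "integrable lborel (\<lambda>t. indicator {x..} t *\<^sub>R f t)"
    using int by (intro integrable_mult_indicator) auto
  then have "((\<lambda>y. LINT t|lborel. indicator {..y} t *\<^sub>R (indicator {x..} t *\<^sub>R f t))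
      \<longlongrightarrow> (LINT t:{x..}|lborel. f t)) at_top"
    unfolding set_lebesgue_integral_def by (intro tendsto_integral_at_top) auto
  moreover have "((\<lambda>y. LINT t|lborel. indicator {..y} t *\<^sub>R (indicator {x..} t *\<^sub>R f t)) \<longlongrightarrow> - F x) at_top"
  proof (rule Lim_transform_eventually)
    show "((\<lambda>y. F y - F x) \<longlongrightarrow> - F x) at_top" using tendsto_diff[OF lim tendsto_const, of "F x"] by simp
    show "\<forall>\<^sub>F y in at_top. F y - F x = (LINT t|lborel. indicator {..y} t *\<^sub>R (indicator {x..} t *\<^sub>R f t))"
      using eventually_ge_at_top[of x]
    proof eventually_elim
      case (elim y)
      then have "F y - F x = (LINT t:{x..y}|lborel. f t)"
        by (rule integral_Icc_eq[OF F f, symmetric])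
      also have "\<dots> = (LINT t|lborel. indicator {..y} t *\<^sub>R (indicator {x..} t *\<^sub>R f t))"
        unfolding set_lebesgue_integral_def
        by (intro Bochner_Integration.integral_cong) (auto split: split_indicator)
      finally show ?case .
    qed
  qed
  ultimately show ?thesis by (rule tendsto_unique[rotated]) simp
qed

text \<open>The lower integral and any antiderivative have the same increments over compact
  intervals, so they differ by a constant.\<close>

lemma DERIV_lower_integral:
  fixes f :: "real \<Rightarrow> real"
  assumes f: "continuous_on UNIV f" and int: "integrable lborel f"
  shows "DERIV (\<lambda>x. LINT t:{..x}|lborel. f t) y :> f y"
proof -
  have "\<exists>F. \<forall>x :: real. -\<infinity> < ereal x \<longrightarrow> ereal x < \<infinity> \<longrightarrow> (F has_vector_derivative f x) (at x)"
    using f by (intro einterval_antiderivative) (auto simp: continuous_on_eq_continuous_at)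
  then obtain F where F: "\<And>x. DERIV F x :> f x"
    by (auto simp: has_real_derivative_iff_has_vector_derivative)
  have si: "set_integrable lborel A f" if "A \<in> sets borel" for A
    unfolding set_integrable_def using that int by (intro integrable_mult_indicator) auto
  define A where "A = (\<lambda>x. LINT t:{..x}|lborel. f t)"
  have step: "A z - F z = A x - F x" if "x \<le> z" for x z
  proof -
    have "A z = (LINT t:{..x} \<union> {x..z}|lborel. f t)"
      unfolding A_def using that by (intro arg_cong[where f="\<lambda>S. LINT t:S|lborel. f t"]) auto
    also have "\<dots> = A x + (LINT t:{x..z}|lborel. f t)"
      unfolding A_def
    proof (rule set_integral_Un_AE)
      show "AE t in lborel. \<not> (t \<in> {..x} \<and> t \<in> {x..z})"
        using AE_lborel_singleton[of x] by eventually_elim auto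
    qed (auto intro: si)
    also have "(LINT t:{x..z}|lborel. f t) = F z - F x"
      using that by (rule integral_Icc_eq[OF F f])
    finally show ?thesis by simp
  qed
  have "A x = F x + (A 0 - F 0)" for x
    using step[of 0 x] step[of x 0] by (cases "0 \<le> x") auto
  then have "A = (\<lambda>x. F x + (A 0 - F 0))" by (rule ext)
  moreover have "DERIV (\<lambda>x. F x + (A 0 - F 0)) y :> f y"
    by (rule derivative_eq_intros F refl | simp)+
  ultimately have "DERIV A y :> f y" by (simp only:)
  then show ?thesis by (simp only: A_def)
qed

section \<open>Truncated moments and tail inequalities of the normal law\<close>

definition normal_tail :: "real \<Rightarrow> real" where "normal_tail x = (LINT t:{x..}|lborel. \<psi> t)"

lemma std_normal_moment_integrable: "integrable lborel (\<lambda>t. t ^ k * \<psi> t)"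
  using integrable_std_normal_moment[of k] by (simp add: mult.commute)

lemma std_normal_moments_integrable:
  "integrable lborel \<psi>" "integrable lborel (\<lambda>t. t * \<psi> t)" "integrable lborel (\<lambda>t. t\<^sup>2 * \<psi> t)"
  using std_normal_moment_integrable[of 0] std_normal_moment_integrable[of 1] std_normal_moment_integrable[of 2]
  by simp_all

lemma normal_tail_set_integrable:
  "A \<in> sets borel \<Longrightarrow> set_integrable lborel A \<psi>"
  "A \<in> sets borel \<Longrightarrow> set_integrable lborel A (\<lambda>t. t * \<psi> t)"
  "A \<in> sets borel \<Longrightarrow> set_integrable lborel A (\<lambda>t. t\<^sup>2 * \<psi> t)"
  unfolding set_integrable_def
  by (intro integrable_mult_indicator std_normal_moments_integrable; simp)+

lemma normal_tail_first_moment: "(LINT t:{x..}|lborel. t * \<psi> t) = \<psi> x"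
proof -
  have "(LINT t:{x..}|lborel. t * \<psi> t) = - (- \<psi> x)"
  proof (rule integral_atLeast_eq)
    show "((\<lambda>x. - \<psi> x) \<longlongrightarrow> 0) at_top"
      using tendsto_minus[OF std_normal_density_at_top[of 0]] by simp
  qed (auto intro!: derivative_eq_intros DERIV_std_normal_density continuous_intros
      continuous_std_normal_density std_normal_moments_integrable)
  then show ?thesis by simp
qed

lemma normal_tail_second_moment: "(LINT t:{x..}|lborel. t\<^sup>2 * \<psi> t) = x * \<psi> x + normal_tail x"
proof -
  have "(LINT t:{x..}|lborel. t\<^sup>2 * \<psi> t - \<psi> t) = - (- (x * \<psi> x))"
  proof (rule integral_atLeast_eq)
    show "((\<lambda>x. - (x * \<psi> x)) \<longlongrightarrow> 0) at_top"
      using tendsto_minus[OF std_normal_density_at_top[of 1]] by simp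
    show "DERIV (\<lambda>x. - (x * \<psi> x)) t :> t\<^sup>2 * \<psi> t - \<psi> t" for t
      by (auto intro!: derivative_eq_intros DERIV_std_normal_density simp: power2_eq_square)
  qed (intro continuous_intros continuous_std_normal_density Bochner_Integration.integrable_diff
      std_normal_moments_integrable)+
  moreover have "(LINT t:{x..}|lborel. t\<^sup>2 * \<psi> t - \<psi> t) = (LINT t:{x..}|lborel. t\<^sup>2 * \<psi> t) - normal_tail x"
    unfolding normal_tail_def by (intro set_integral_diff normal_tail_set_integrable) auto
  ultimately show ?thesis by simp
qed

text \<open>Truncated moments up to order 2 are expressible in \<open>\<psi> x\<close> and
  \<open>normal_tail x\<close>. Each quadratic that is nonnegative on \<open>{x..}\<close> therefore
  yields a linear inequality between these two numbers, the starting point of the tail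
  bounds.\<close>

lemma normal_tail_quadratic:
  "(LINT t:{x..}|lborel. (a * t\<^sup>2 + b * t + c) * \<psi> t) = a * (x * \<psi> x + normal_tail x) + b * \<psi> x + c * normal_tail x"
proof -
  have "(LINT t:{x..}|lborel. (a * t\<^sup>2 + b * t + c) * \<psi> t)
    = (LINT t:{x..}|lborel. a * (t\<^sup>2 * \<psi> t) + (b * (t * \<psi> t) + c * \<psi> t))"
    by (simp add: algebra_simps)
  also have "\<dots> = (LINT t:{x..}|lborel. a * (t\<^sup>2 * \<psi> t)) + ((LINT t:{x..}|lborel. b * (t * \<psi> t)) + (LINT t:{x..}|lborel. c * \<psi> t))"
    by (simp add: set_integral_add normal_tail_set_integrable)
  also have "\<dots> = a * (x * \<psi> x + normal_tail x) + b * \<psi> x + c * normal_tail x"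
    by (simp add: normal_tail_first_moment normal_tail_second_moment normal_tail_def[symmetric])
  finally show ?thesis .
qed

lemma set_lborel_integral_nonneg: "(\<And>t. t \<in> A \<Longrightarrow> 0 \<le> f t) \<Longrightarrow> 0 \<le> (LINT t:A|lborel. f t :: real)"
  unfolding set_lebesgue_integral_def by (intro Bochner_Integration.integral_nonneg) (auto split: split_indicator)

text \<open>With \<open>q = m / \<psi> x\<close>, the Cauchy--Schwarz inequality between the moments of order 0, 1, 2 of \<open>t - x\<close>
  under \<open>\<psi>\<close> on \<open>{x..}\<close> reads \<open>x\<^sup>2 q \<le> (1 - q)\<^sup>2\<close>. For \<open>v = sqrt q\<close> this gives \<open>x v \<le> 1 - v\<^sup>2\<close>, and
  the claim reduces to \<open>0 \<le> 1 - 2 v (1 - v\<^sup>2) - v\<^sup>4 = (1 - v)\<^sup>3 (1 + v)\<close>.\<close>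

lemma normal_tail_bounds:
  assumes "x \<ge> 0"
  defines "m \<equiv> \<psi> x - x * normal_tail x"
  shows "0 \<le> normal_tail x" "0 \<le> m" "m * (x + sqrt (1 + x\<^sup>2)) \<le> \<psi> x"
proof -
  note p = std_normal_density_pos[of x]
  have quad: "0 \<le> a * (x * \<psi> x + normal_tail x) + b * \<psi> x + c * normal_tail x"
    if "\<And>t. t \<ge> x \<Longrightarrow> 0 \<le> a * t\<^sup>2 + b * t + c" for a b c
    using that unfolding normal_tail_quadratic[symmetric]
    by (intro set_lborel_integral_nonneg mult_nonneg_nonneg) (auto simp: less_imp_le[OF std_normal_density_pos])
  show m0: "0 \<le> normal_tail x" using quad[of 0 0 1] by simp
  show m: "0 \<le> m" using quad[of 0 1 "-x"] by (simp add: m_def)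
  \<comment> \<open>This is the integral of \<open>(t - x - l)^2 * \<psi> t\<close> over
    \<open>{x..}\<close>: the moments of \<open>t - x\<close> there are
    \<open>normal_tail x\<close>, \<open>m\<close> and \<open>normal_tail x - x * m\<close>.\<close>
  have sqr: "0 \<le> normal_tail x - x * m - 2 * l * m + l\<^sup>2 * normal_tail x" for l
  proof -
    have "0 \<le> 1 * (x * \<psi> x + normal_tail x) + (- 2 * (x + l)) * \<psi> x + (x + l)\<^sup>2 * normal_tail x"
    proof (rule quad)
      fix t have "1 * t\<^sup>2 + (- 2 * (x + l)) * t + (x + l)\<^sup>2 = (t - (x + l))\<^sup>2"
        by (simp add: power2_eq_square algebra_simps)
      then show "0 \<le> 1 * t\<^sup>2 + (- 2 * (x + l)) * t + (x + l)\<^sup>2" by simp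
    qed
    then show ?thesis by (simp add: m_def power2_eq_square algebra_simps)
  qed
  have key: "x\<^sup>2 * m * \<psi> x \<le> (\<psi> x - m)\<^sup>2"
  proof (cases "x = 0")
    case False
    with assms have x: "x > 0" by simp
    have "normal_tail x \<noteq> 0"
    proof
      assume 0: "normal_tail x = 0"
      then have "m = \<psi> x" by (simp add: m_def)
      with sqr[of 0] 0 x p show False using mult_pos_pos[OF x p] by simp
    qed
    with m0 have M: "normal_tail x > 0" by simp
    \<comment> \<open>The value \<open>l = m / normal_tail x\<close> minimizes the quadratic in
      \<open>l\<close>. The later factor \<open>x^2\<close> lets
      \<open>x * normal_tail x = \<psi> x - m\<close> eliminate the tail.\<close>
    have "0 \<le> normal_tail x * (normal_tail x - x * m - 2 * (m / normal_tail x) * m + (m / normal_tail x)\<^sup>2 * normal_tail x)"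
      using sqr[of "m / normal_tail x"] m0 by (intro mult_nonneg_nonneg)
    also have "\<dots> = (normal_tail x)\<^sup>2 - x * normal_tail x * m - m\<^sup>2"
      using M by (simp add: field_simps power2_eq_square)
    finally have "m\<^sup>2 \<le> (normal_tail x)\<^sup>2 - x * normal_tail x * m" by simp
    then have "x\<^sup>2 * m\<^sup>2 \<le> x\<^sup>2 * ((normal_tail x)\<^sup>2 - x * normal_tail x * m)"
      by (intro mult_left_mono) auto
    also have "\<dots> = (x * normal_tail x)\<^sup>2 - x\<^sup>2 * (x * normal_tail x) * m"
      by (simp add: power2_eq_square algebra_simps)
    also have "x * normal_tail x = \<psi> x - m" by (simp add: m_def)
    finally show ?thesis by (simp add: power2_eq_square algebra_simps)
  qed simp
  define q where "q = m / \<psi> x"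
  define v where "v = sqrt q"
  have q: "0 \<le> q" "q \<le> 1" using m p m0 assms by (auto simp: q_def m_def)
  then have v: "0 \<le> v" "v \<le> 1" "q = v\<^sup>2" by (auto simp: v_def)
  have "x\<^sup>2 * q = (x\<^sup>2 * m * \<psi> x) / (\<psi> x)\<^sup>2" using p by (simp add: q_def power2_eq_square)
  also have "\<dots> \<le> (\<psi> x - m)\<^sup>2 / (\<psi> x)\<^sup>2" using key by (intro divide_right_mono) auto
  also have "(\<psi> x - m)\<^sup>2 / (\<psi> x)\<^sup>2 = (1 - q)\<^sup>2"
    using p by (simp add: q_def diff_divide_distrib flip: power_divide)
  finally have xq: "x\<^sup>2 * q \<le> (1 - q)\<^sup>2" .
  have "x\<^sup>2 * q = (x * v)\<^sup>2" unfolding v(3) power_mult_distrib ..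
  with xq have "(x * v)\<^sup>2 \<le> (1 - q)\<^sup>2" by (simp only:)
  then have "x * v \<le> 1 - q" using q by (intro power2_le_imp_le[of "x * v" "1 - q"]) auto
  then have xv: "x * v \<le> 1 - v\<^sup>2" by (subst v(3)[symmetric])
  have qx: "q * x \<le> v * (1 - v\<^sup>2)"
    using mult_left_mono[OF xv v(1)] by (simp add: v(3) power2_eq_square algebra_simps)
  have "0 \<le> (1 - v) ^ 3 * (1 + v)" using v by (intro mult_nonneg_nonneg) auto
  also have "\<dots> = 1 - 2 * (v * (1 - v\<^sup>2)) - q\<^sup>2"
    by (simp add: v(3) power2_eq_square power3_eq_cube algebra_simps)
  finally have *: "q\<^sup>2 + 2 * (q * x) \<le> 1" using qx by simp
  have "q * x \<le> 1"
    using * zero_le_power2[of q] mult_nonneg_nonneg[OF q(1) assms(1)] by linarith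
  \<comment> \<open>After squaring, \<open>q^2 * x^2\<close> cancels and
    \<open>q^2 + 2 * (q * x) \<le> 1\<close> remains, which has just been shown.\<close>
  have "q * sqrt (1 + x\<^sup>2) \<le> 1 - q * x"
  proof (rule power2_le_imp_le)
    have "(q * sqrt (1 + x\<^sup>2))\<^sup>2 = q\<^sup>2 * (1 + x\<^sup>2)" by (simp add: power_mult_distrib)
    also have "\<dots> \<le> (1 - q * x)\<^sup>2" using * by (simp add: power2_eq_square algebra_simps)
    finally show "(q * sqrt (1 + x\<^sup>2))\<^sup>2 \<le> (1 - q * x)\<^sup>2" .
  qed (use \<open>q * x \<le> 1\<close> in simp)
  then have "q * (x + sqrt (1 + x\<^sup>2)) \<le> 1" by (simp add: algebra_simps)
  then show "m * (x + sqrt (1 + x\<^sup>2)) \<le> \<psi> x" using p by (simp add: q_def field_simps)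
qed

section \<open>Bounds on the derivative of the Stein solution\<close>

text \<open>The integral is at most \<open>normal_tail x\<close> in absolute value, and
  \<open>x * normal_tail x \<le> \<psi> x\<close>; so both terms are at most
  \<open>\<psi> x\<close>, whence the factor 2.\<close>

lemma tail_bound_bounded:
  assumes x: "x \<ge> 0" and int: "integrable lborel (\<lambda>t. a t * \<psi> t)" and a: "\<And>t. \<bar>a t\<bar> \<le> 1"
  shows "\<bar>a x * \<psi> x - x * (LINT t:{x..}|lborel. a t * \<psi> t)\<bar> \<le> 2 * \<psi> x"
proof -
  have "\<bar>LINT t:{x..}|lborel. a t * \<psi> t\<bar> \<le> normal_tail x"
    unfolding normal_tail_def set_lebesgue_integral_def
  proof (rule integral_abs_bound_integral)
    fix t have "\<bar>a t * \<psi> t\<bar> \<le> 1 * \<psi> t"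
      unfolding abs_mult using a std_normal_density_pos[of t] by (intro mult_mono) auto
    then show "\<bar>indicator {x..} t *\<^sub>R (a t * \<psi> t)\<bar> \<le> indicator {x..} t *\<^sub>R \<psi> t"
      by (auto split: split_indicator)
  qed (intro integrable_mult_indicator int std_normal_moments_integrable; simp)+
  then have "\<bar>x * (LINT t:{x..}|lborel. a t * \<psi> t)\<bar> \<le> x * normal_tail x"
    unfolding abs_mult using x by (intro mult_mono) auto
  moreover have "\<bar>a x * \<psi> x\<bar> \<le> 1 * \<psi> x"
    unfolding abs_mult using a std_normal_density_pos[of x] by (intro mult_mono) auto
  ultimately show ?thesis using normal_tail_bounds[OF x] by linarith
qed

text \<open>Splitting \<open>a t\<close> as \<open>a x + (a t - a x)\<close> turns the left side
  into \<open>a x * m - x * J\<close> with \<open>\<bar>J\<bar> \<le> m\<close>. It is thus at most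
  \<open>(sqrt (1 + x^2) + x) * m\<close>, exactly the quantity bounded in
  \<open>normal_tail_bounds\<close>.\<close>

lemma tail_bound_lipschitz:
  assumes x: "x \<ge> 0" and int: "integrable lborel (\<lambda>t. a t * \<psi> t)" and a: "\<And>t. \<bar>a t - a x\<bar> \<le> \<bar>t - x\<bar>"
    and ax: "\<bar>a x\<bar> \<le> sqrt (1 + x\<^sup>2)"
  shows "\<bar>a x * \<psi> x - x * (LINT t:{x..}|lborel. a t * \<psi> t)\<bar> \<le> \<psi> x"
proof -
  define m where "m = \<psi> x - x * normal_tail x"
  have si: "set_integrable lborel {x..} (\<lambda>t. a t * \<psi> t)"
    unfolding set_integrable_def using int by (intro integrable_mult_indicator) auto
  have "(LINT t:{x..}|lborel. (a t - a x) * \<psi> t)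
    = (LINT t:{x..}|lborel. a t * \<psi> t - a x * \<psi> t)" by (simp add: algebra_simps)
  also have "\<dots> = (LINT t:{x..}|lborel. a t * \<psi> t) - a x * normal_tail x"
    unfolding normal_tail_def set_integral_mult_right[symmetric]
    by (rule set_integral_diff(2)[OF si set_integrable_mult_right[OF normal_tail_set_integrable(1)]]) simp
  finally have eq: "(LINT t:{x..}|lborel. a t * \<psi> t) = a x * normal_tail x + (LINT t:{x..}|lborel. (a t - a x) * \<psi> t)"
    by simp
  have si2: "set_integrable lborel {x..} (\<lambda>t. (a t - a x) * \<psi> t)"
    unfolding left_diff_distrib
    by (rule set_integral_diff(1)[OF si set_integrable_mult_right[OF normal_tail_set_integrable(1)]]) simp
  have si3: "set_integrable lborel {x..} (\<lambda>t. (t - x) * \<psi> t)"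
    unfolding left_diff_distrib
    by (intro set_integral_diff(1) set_integrable_mult_right normal_tail_set_integrable) auto
  have "\<bar>LINT t:{x..}|lborel. (a t - a x) * \<psi> t\<bar> \<le> (LINT t:{x..}|lborel. (t - x) * \<psi> t)"
    unfolding set_lebesgue_integral_def
  proof (rule integral_abs_bound_integral)
    fix t show "\<bar>indicator {x..} t *\<^sub>R ((a t - a x) * \<psi> t)\<bar> \<le> indicator {x..} t *\<^sub>R ((t - x) * \<psi> t)"
      using a[of t] std_normal_density_pos[of t] by (auto simp: abs_mult split: split_indicator)
  qed (use si2 si3 in \<open>auto simp: set_integrable_def\<close>)
  also have "\<dots> = m" using normal_tail_quadratic[of x 0 1 "-x"] by (simp add: m_def)
  finally have b: "\<bar>x * (LINT t:{x..}|lborel. (a t - a x) * \<psi> t)\<bar> \<le> x * m"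
    unfolding abs_mult using x by (intro mult_mono) auto
  have m: "0 \<le> m" using normal_tail_bounds(2)[OF x] by (simp add: m_def)
  define J where "J = (LINT t:{x..}|lborel. (a t - a x) * \<psi> t)"
  have "a x * \<psi> x - x * (LINT t:{x..}|lborel. a t * \<psi> t) = a x * m - x * J"
    unfolding eq J_def[symmetric] m_def by (simp add: algebra_simps)
  also have "\<bar>\<dots>\<bar> \<le> \<bar>a x * m\<bar> + \<bar>x * J\<bar>" by (rule abs_triangle_ineq4)
  also have "\<dots> \<le> \<bar>a x\<bar> * m + x * m" using b m by (simp add: abs_mult J_def)
  also have "\<dots> \<le> sqrt (1 + x\<^sup>2) * m + x * m" using ax m by (intro add_right_mono mult_right_mono) auto
  also have "\<dots> \<le> \<psi> x" using normal_tail_bounds(3)[OF x] by (simp add: m_def algebra_simps)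
  finally show ?thesis .
qed

text \<open>The bound on the negative half-line is the one on the positive half-line for the reflected function.\<close>

lemma stein_equation:
  fixes a :: "real \<Rightarrow> real"
  assumes a: "continuous_on UNIV a" and int: "integrable lborel (\<lambda>t. a t * \<psi> t)"
    and zero: "(LINT t|lborel. a t * \<psi> t) = 0"
    and bound: "\<And>x. x \<ge> 0 \<Longrightarrow> \<bar>a x * \<psi> x - x * (LINT t:{x..}|lborel. a t * \<psi> t)\<bar> \<le> B * \<psi> x"
    and bound': "\<And>x. x \<ge> 0 \<Longrightarrow> \<bar>a (-x) * \<psi> x - x * (LINT t:{x..}|lborel. a (-t) * \<psi> t)\<bar> \<le> B * \<psi> x"
  obtains G u where "\<And>x. DERIV G x :> u x" "continuous_on UNIV u" "\<And>x. \<bar>u x\<bar> \<le> B"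
    "\<And>x. u x = x * G x + a x"
proof -
  define A where "A = (\<lambda>x. LINT t:{..x}|lborel. a t * \<psi> t)"
  \<comment> \<open>Since \<open>\<psi>' = - x * \<psi>\<close>, the density is an integrating
    factor: the Stein equation says that \<open>G * \<psi>\<close> has derivative
    \<open>a * \<psi>\<close>.\<close>
  define G where "G = (\<lambda>x. A x / \<psi> x)"
  define u where "u = (\<lambda>x. x * G x + a x)"
  have p: "\<psi> x > 0" "\<psi> x \<noteq> 0" for x using std_normal_density_pos[of x] by auto
  have A: "DERIV A x :> a x * \<psi> x" for x
    unfolding A_def by (intro DERIV_lower_integral int continuous_intros a continuous_std_normal_density)
  have G: "DERIV G x :> u x" for x
  proof -
    have "DERIV G x :> (a x * \<psi> x * \<psi> x - A x * (- x * \<psi> x)) / (\<psi> x * \<psi> x)"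
      unfolding G_def by (intro DERIV_divide A DERIV_std_normal_density p)
    also have "(a x * \<psi> x * \<psi> x - A x * (- x * \<psi> x)) / (\<psi> x * \<psi> x) = u x"
      using p(2)[of x] by (simp add: u_def G_def field_simps)
    finally show ?thesis .
  qed
  have "continuous_on UNIV G"
    by (rule DERIV_continuous_on[where D=u]) (simp add: G)
  then have cu: "continuous_on UNIV u" unfolding u_def by (intro continuous_intros a)
  \<comment> \<open>The total integral is 0, so the lower integral is minus the upper one; this form
    meets the hypothesis \<open>bound\<close> for \<open>x \<ge> 0\<close>.\<close>
  have upper: "A x = - (LINT t:{x..}|lborel. a t * \<psi> t)" for x
  proof -
    have si: "set_integrable lborel S (\<lambda>t. a t * \<psi> t)" if "S \<in> sets borel" for S
      unfolding set_integrable_def using that int by (intro integrable_mult_indicator) auto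
    have "A x + (LINT t:{x..}|lborel. a t * \<psi> t) = (LINT t:{..x} \<union> {x..}|lborel. a t * \<psi> t)"
      unfolding A_def
    proof (rule set_integral_Un_AE[symmetric])
      show "AE t in lborel. \<not> (t \<in> {..x} \<and> t \<in> {x..})"
        using AE_lborel_singleton[of x] by eventually_elim auto
    qed (auto intro: si)
    also have "{..x} \<union> {x..} = UNIV" by auto
    also have "(LINT t:UNIV|lborel. a t * \<psi> t) = 0" using zero by (simp add: set_lebesgue_integral_def)
    finally show ?thesis by simp
  qed
  have refl: "A x = (LINT t:{-x..}|lborel. a (-t) * \<psi> t)" for x
  proof -
    have "{t. - t \<in> {..x}} = {-x..}" by auto
    moreover have "\<psi> (-t) = \<psi> t" for t by (simp add: std_normal_density_def)
    ultimately show ?thesis unfolding A_def by (subst set_integral_reflect) simp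
  qed
  have ub: "\<bar>u x\<bar> \<le> B" for x
  proof -
    have "\<bar>u x * \<psi> x\<bar> \<le> B * \<psi> x"
    proof (cases "x \<ge> 0")
      case True
      have "u x * \<psi> x = a x * \<psi> x - x * (LINT t:{x..}|lborel. a t * \<psi> t)"
        using p(2)[of x] by (simp add: u_def G_def upper field_simps)
      then show ?thesis using bound[OF True] by simp
    next
      case False
      have "\<psi> (-x) = \<psi> x" by (simp add: std_normal_density_def)
      moreover have "u x * \<psi> x = a x * \<psi> x + x * A x"
        using p(2)[of x] by (simp add: u_def G_def field_simps)
      ultimately show ?thesis using bound'[of "-x"] False by (simp add: refl)
    qed
    then show ?thesis using p(1)[of x] by (simp add: abs_mult)
  qed
  show ?thesis by (rule that[OF G cu ub]) (simp add: u_def)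
qed

lemma integral_std_normal_density: "(LINT t|lborel. \<psi> t) = 1"
  using integral_std_normal_moment_even[of 0] by simp

lemma normal_centered:
  fixes h :: "real \<Rightarrow> real"
  assumes int: "integrable lborel (\<lambda>t. h t * \<psi> t)"
  defines "c \<equiv> (LINT t|lborel. h t * \<psi> t)"
  shows "integrable lborel (\<lambda>t. (h t - c) * \<psi> t)" "(LINT t|lborel. (h t - c) * \<psi> t) = 0"
  unfolding left_diff_distrib using int std_normal_moments_integrable(1)
  by (simp_all add: c_def[symmetric] integral_std_normal_density)

lemma integrable_reflect:
  fixes f :: "real \<Rightarrow> real"
  shows "integrable lborel f \<Longrightarrow> integrable lborel (\<lambda>t. f (-t))"
  using lborel_integrable_real_affine[of f "-1" 0] by simp

lemma stein_solution_bounded: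
  fixes h :: "real \<Rightarrow> real"
  assumes h: "continuous_on UNIV h" and h01: "\<And>x. 0 \<le> h x" "\<And>x. h x \<le> 1"
  defines "c \<equiv> (LINT t|lborel. h t * \<psi> t)"
  obtains G u where "\<And>x. DERIV G x :> u x" "continuous_on UNIV u" "\<And>x. \<bar>u x\<bar> \<le> 2"
    "\<And>x. u x = x * G x + (h x - c)"
proof -
  have [measurable]: "h \<in> borel_measurable borel"
    using h by (rule borel_measurable_continuous_onI)
  have int: "integrable lborel (\<lambda>t. h t * \<psi> t)"
  proof (rule Bochner_Integration.integrable_bound[OF std_normal_moments_integrable(1)])
    have "\<bar>h t * \<psi> t\<bar> \<le> 1 * \<psi> t" for t
      unfolding abs_mult using h01[of t] std_normal_density_pos[of t] by (intro mult_mono) auto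
    then show "AE t in lborel. norm (h t * \<psi> t) \<le> norm (\<psi> t)" by auto
  qed simp
  have "0 \<le> c" unfolding c_def
    using h01 less_imp_le[OF std_normal_density_pos] by (intro Bochner_Integration.integral_nonneg) auto
  moreover have "c \<le> (LINT t|lborel. \<psi> t)" unfolding c_def
    using h01 less_imp_le[OF std_normal_density_pos]
    by (intro integral_mono int std_normal_moments_integrable) (simp add: mult_left_le_one_le)
  ultimately have a: "\<bar>h x - c\<bar> \<le> 1" for x
    using h01[of x] by (auto simp: integral_std_normal_density)
  note cint = normal_centered[OF int, folded c_def]
  have refl: "integrable lborel (\<lambda>t. (h (-t) - c) * \<psi> t)"
    using integrable_reflect[OF cint(1)] by (simp add: std_normal_density_def)
  show ?thesis
    by (rule stein_equation[OF _ cint _ _ that])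
      (auto intro!: continuous_intros h tail_bound_bounded cint refl a
          tail_bound_bounded[of _ "\<lambda>t. h (-t) - c"])
qed

text \<open>The growth condition of \<open>tail_bound_lipschitz\<close> holds because
  \<open>\<bar>h x - c\<bar>\<close> is at most the mean of \<open>\<bar>\<N> - x\<bar>\<close>,
  hence at most \<open>sqrt (1 + x^2)\<close>. The AM-GM majorant \<open>w\<close> gives this bound
  and the integrability of \<open>h * \<psi>\<close> at once.\<close>

lemma stein_solution_lipschitz:
  fixes h :: "real \<Rightarrow> real"
  assumes h: "1-lipschitz_on UNIV h"
  defines "c \<equiv> (LINT t|lborel. h t * \<psi> t)"
  obtains G u where "\<And>x. DERIV G x :> u x" "continuous_on UNIV u" "\<And>x. \<bar>u x\<bar> \<le> 1"
    "\<And>x. u x = x * G x + (h x - c)"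
proof -
  have ch: "continuous_on UNIV h" using h by (rule lipschitz_on_continuous_on)
  then have [measurable]: "h \<in> borel_measurable borel"
    by (rule borel_measurable_continuous_onI)
  have lip: "\<bar>h x - h y\<bar> \<le> \<bar>x - y\<bar>" for x y
    using lipschitz_onD[OF h, of x y] by (simp add: dist_real_def)
  define s where "s = (\<lambda>x::real. sqrt (1 + x\<^sup>2))"
  have s: "s x > 0" "(s x)\<^sup>2 = 1 + x\<^sup>2" for x by (auto simp: s_def add_pos_nonneg)
  \<comment> \<open>AM-GM: \<open>\<bar>t - x\<bar> \<le> w x t\<close>, and \<open>w x\<close> has normal expectation \<open>sqrt (1 + x\<^sup>2)\<close>\<close>
  define w where "w = (\<lambda>x t. (((t - x)\<^sup>2 / s x + s x) / 2))"
  have w: "\<bar>t - x\<bar> \<le> w x t" for x t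
  proof -
    have "0 \<le> (\<bar>t - x\<bar> - s x)\<^sup>2" by simp
    then have "2 * (s x * \<bar>t - x\<bar>) \<le> (t - x)\<^sup>2 + s x * s x"
      by (simp add: power2_eq_square algebra_simps)
    then show ?thesis using s(1)[of x] by (simp add: w_def field_simps)
  qed
  have wint: "has_bochner_integral lborel (\<lambda>t. w x t * \<psi> t) (s x)" for x
  proof -
    have m: "has_bochner_integral lborel (\<lambda>t. t\<^sup>2 * \<psi> t) 1" "has_bochner_integral lborel (\<lambda>t. t * \<psi> t) 0"
       "has_bochner_integral lborel \<psi> 1"
      using std_normal_moment_even[of 1] std_normal_moment_odd[of 0] std_normal_moment_even[of 0]
      by (auto simp: mult.commute fact_numeral)
    have "has_bochner_integral lborel (\<lambda>t. 1 / (2 * s x) * (t\<^sup>2 * \<psi> t) + (- x / s x * (t * \<psi> t) + (x\<^sup>2 / s x + s x) / 2 * \<psi> t))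
       (1 / (2 * s x) * 1 + (- x / s x * 0 + (x\<^sup>2 / s x + s x) / 2 * 1))"
      by (intro has_bochner_integral_add has_bochner_integral_mult_right m)
    moreover have "1 / (2 * s x) * 1 + (- x / s x * 0 + (x\<^sup>2 / s x + s x) / 2 * 1) = s x"
      using s[of x] by (simp add: field_simps power2_eq_square)
    moreover have "(\<lambda>t. 1 / (2 * s x) * (t\<^sup>2 * \<psi> t) + (- x / s x * (t * \<psi> t) + (x\<^sup>2 / s x + s x) / 2 * \<psi> t)) = (\<lambda>t. w x t * \<psi> t)"
      using s(1)[of x] by (intro ext) (simp add: w_def field_simps power2_eq_square)
    ultimately show ?thesis by simp
  qed
  have diff: "\<bar>(h t - h x) * \<psi> t\<bar> \<le> w x t * \<psi> t" for x t
    unfolding abs_mult using lip[of t x] w[of t x] std_normal_density_pos[of t] by (intro mult_mono) auto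
  have dint: "integrable lborel (\<lambda>t. (h t - h x) * \<psi> t)" for x
    by (rule Bochner_Integration.integrable_bound[of _ "\<lambda>t. w x t * \<psi> t"])
       (use wint[of x] diff in \<open>auto simp: has_bochner_integral_iff intro: order_trans[OF _ abs_ge_self]\<close>)
  have "integrable lborel (\<lambda>t. (h t - h 0) * \<psi> t + h 0 * \<psi> t)"
    using dint[of 0] std_normal_moments_integrable(1) by (intro Bochner_Integration.integrable_add integrable_mult_right)
  then have int: "integrable lborel (\<lambda>t. h t * \<psi> t)" by (simp add: algebra_simps)
  note cint = normal_centered[OF int, folded c_def]
  have ax: "\<bar>h x - c\<bar> \<le> sqrt (1 + x\<^sup>2)" for x
  proof -
    have "(LINT t|lborel. (h t - h x) * \<psi> t) = c - h x"
      unfolding left_diff_distrib using int std_normal_moments_integrable(1)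
      by (simp add: c_def[symmetric] integral_std_normal_density)
    then have "\<bar>h x - c\<bar> = \<bar>LINT t|lborel. (h t - h x) * \<psi> t\<bar>" by simp
    also have "\<dots> \<le> (LINT t|lborel. w x t * \<psi> t)"
      using wint[of x] by (intro integral_abs_bound_integral dint diff) (auto simp: has_bochner_integral_iff)
    also have "\<dots> = s x" using wint[of x] by (simp add: has_bochner_integral_iff)
    finally show ?thesis by (simp add: s_def)
  qed
  have refl: "integrable lborel (\<lambda>t. (h (-t) - c) * \<psi> t)"
    using integrable_reflect[OF cint(1)] by (simp add: std_normal_density_def)
  show ?thesis
  proof (rule stein_equation[OF _ cint _ _ that])
    fix x :: real assume x: "x \<ge> 0"
    show "\<bar>(h x - c) * \<psi> x - x * (LINT t:{x..}|lborel. (h t - c) * \<psi> t)\<bar> \<le> 1 * \<psi> x"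
      using tail_bound_lipschitz[OF x cint(1)] lip ax by simp
    have "\<bar>h (- t) - h (- x)\<bar> \<le> \<bar>t - x\<bar>" for t using lip[of "-t" "-x"] by simp
    moreover have "\<bar>h (- x) - c\<bar> \<le> sqrt (1 + x\<^sup>2)" using ax[of "-x"] by simp
    ultimately show "\<bar>(h (-x) - c) * \<psi> x - x * (LINT t:{x..}|lborel. (h (-t) - c) * \<psi> t)\<bar> \<le> 1 * \<psi> x"
      using tail_bound_lipschitz[OF x refl] by simp
  qed (auto intro!: continuous_intros ch)
qed

section \<open>Sums of independent variables\<close>

text \<open>Centered independent terms are orthogonal, so the cross term of the induction step has
  mean 0. It serves twice: for the summands of \<open>Z\<close>, and for the centered
  kernels.\<close>

lemma (in prob_space) indep_sum_square:
  fixes C :: "'i \<Rightarrow> 'a \<Rightarrow> real"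
  assumes "finite I" "indep_vars (\<lambda>_. borel) C I"
    and "\<And>i. i \<in> I \<Longrightarrow> integrable M (\<lambda>\<omega>. (C i \<omega>)\<^sup>2)"
    and "\<And>i. i \<in> I \<Longrightarrow> expectation (C i) = 0"
  shows "integrable M (\<lambda>\<omega>. (\<Sum>i\<in>I. C i \<omega>)\<^sup>2)
    \<and> expectation (\<lambda>\<omega>. (\<Sum>i\<in>I. C i \<omega>)\<^sup>2) = (\<Sum>i\<in>I. expectation (\<lambda>\<omega>. (C i \<omega>)\<^sup>2))"
  using assms
proof (induction I rule: finite_induct)
  case (insert i I)
  define W where "W = (\<lambda>\<omega>. \<Sum>i\<in>I. C i \<omega>)"
  have meas: "C j \<in> borel_measurable M" if "j \<in> insert i I" for j
    using insert.prems(1) that by (auto simp: indep_vars_def)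
  have int: "integrable M (C j)" if "j \<in> insert i I" for j
    using meas[OF that] insert.prems(2)[OF that] by (rule square_integrable_imp_integrable)
  have IH: "integrable M (\<lambda>\<omega>. (W \<omega>)\<^sup>2)"
    "expectation (\<lambda>\<omega>. (W \<omega>)\<^sup>2) = (\<Sum>i\<in>I. expectation (\<lambda>\<omega>. (C i \<omega>)\<^sup>2))"
    using insert.IH[OF indep_vars_subset[OF insert.prems(1)]] insert.prems by (auto simp: W_def)
  have W: "integrable M W" unfolding W_def using int by (intro Bochner_Integration.integrable_sum) auto
  have indep: "indep_var borel (C i) borel W"
    unfolding W_def using insert by (intro indep_vars_sum) auto
  have prod: "integrable M (\<lambda>\<omega>. C i \<omega> * W \<omega>)" "expectation (\<lambda>\<omega>. C i \<omega> * W \<omega>) = 0"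
    using indep_var_integrable[OF indep _ W] indep_var_lebesgue_integral[OF indep _ W] int[of i]
      insert.prems(3)[of i] by auto
  have "(\<lambda>\<omega>. (\<Sum>i\<in>insert i I. C i \<omega>)\<^sup>2) = (\<lambda>\<omega>. (C i \<omega>)\<^sup>2 + 2 * (C i \<omega> * W \<omega>) + (W \<omega>)\<^sup>2)"
    using insert.hyps by (auto simp: W_def power2_eq_square algebra_simps)
  then show ?case using insert.prems(2)[of i] IH prod insert.hyps by simp
qed simp

lemma (in prob_space) expectation_abs_le_sqrt:
  fixes T :: "'a \<Rightarrow> real"
  assumes "integrable M T" "integrable M (\<lambda>\<omega>. (T \<omega>)\<^sup>2)"
  shows "expectation (\<lambda>\<omega>. \<bar>T \<omega>\<bar>) \<le> sqrt (expectation (\<lambda>\<omega>. (T \<omega>)\<^sup>2))"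
proof -
  have "0 \<le> variance (\<lambda>\<omega>. \<bar>T \<omega>\<bar>)" by (rule variance_positive)
  also have "\<dots> = expectation (\<lambda>\<omega>. (T \<omega>)\<^sup>2) - (expectation (\<lambda>\<omega>. \<bar>T \<omega>\<bar>))\<^sup>2"
    using assms by (subst variance_eq) auto
  finally show ?thesis by (intro real_le_rsqrt) simp
qed

lemma (in prob_space) stein_bound:
  fixes X :: "nat \<Rightarrow> 'a \<Rightarrow> real"
  assumes fin: "finite K" and indep: "indep_vars (\<lambda>_. borel) X K"
    and X: "\<And>k. k \<in> K \<Longrightarrow> centered_density_rv M (X k)"
    and sq: "\<And>k. k \<in> K \<Longrightarrow> integrable M (\<lambda>\<omega>. (stein_kernel M (X k) (X k \<omega>))\<^sup>2)"
    and G: "\<And>y. DERIV G y :> u y" and u: "continuous_on UNIV u" and B: "\<And>y. \<bar>u y\<bar> \<le> B"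
  defines "Z \<equiv> (\<lambda>\<omega>. \<Sum>k\<in>K. X k \<omega>)"
  shows "\<bar>expectation (\<lambda>\<omega>. u (Z \<omega>) - Z \<omega> * G (Z \<omega>))\<bar> \<le>
    B * (\<bar>1 - expectation (\<lambda>\<omega>. (Z \<omega>)\<^sup>2)\<bar>
       + sqrt (\<Sum>k\<in>K. expectation (\<lambda>\<omega>. (stein_kernel M (X k) (X k \<omega>))\<^sup>2) - (expectation (\<lambda>\<omega>. (X k \<omega>)\<^sup>2))\<^sup>2))"
proof -
  define Y where "Y = (\<lambda>k \<omega>. stein_kernel M (X k) (X k \<omega>))"
  define S where "S = (\<lambda>\<omega>. \<Sum>k\<in>K. Y k \<omega>)"
  define m where "m = (\<lambda>k. expectation (\<lambda>\<omega>. (X k \<omega>)\<^sup>2))"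
  have Xm[measurable]: "X k \<in> borel_measurable M" if "k \<in> K" for k
    using indep that by (auto simp: indep_vars_def)
  have [measurable]: "u \<in> borel_measurable borel"
    using u by (rule borel_measurable_continuous_onI)
  have Zm[measurable]: "Z \<in> borel_measurable M" unfolding Z_def by measurable
  have Xint: "integrable M (X k)" if "k \<in> K" for k
    using centered_density_rv.integrable_rv[OF X[OF that]] .
  have Yint: "integrable M (Y k)" "expectation (Y k) = m k" if "k \<in> K" for k
    using centered_density_rv.stein_kernel_integrable[OF X[OF that]]
      centered_density_rv.stein_kernel_expectation[OF X[OF that]] by (auto simp: Y_def m_def)
  have id: "integrable M (\<lambda>\<omega>. X k \<omega> * G (Z \<omega>))" "integrable M (\<lambda>\<omega>. Y k \<omega> * u (Z \<omega>))"
      "expectation (\<lambda>\<omega>. X k \<omega> * G (Z \<omega>)) = expectation (\<lambda>\<omega>. Y k \<omega> * u (Z \<omega>))" if k: "k \<in> K" for k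
  proof -
    \<comment> \<open>\<open>Z\<close> is \<open>X k\<close> plus a remainder independent of it, the
      form required by the Stein identity with an independent shift.\<close>
    have Z: "Z = (\<lambda>\<omega>. X k \<omega> + (\<Sum>j\<in>K - {k}. X j \<omega>))"
      unfolding Z_def using fin k by (simp add: sum.remove)
    have "insert k (K - {k}) = K" using k by auto
    then have "indep_var borel (X k) borel (\<lambda>\<omega>. \<Sum>j\<in>K - {k}. X j \<omega>)"
      using indep fin by (intro indep_vars_sum) auto
    moreover have "integrable M (\<lambda>\<omega>. \<Sum>j\<in>K - {k}. X j \<omega>)"
      using Xint by (intro Bochner_Integration.integrable_sum) auto
    ultimately show "integrable M (\<lambda>\<omega>. X k \<omega> * G (Z \<omega>))" "integrable M (\<lambda>\<omega>. Y k \<omega> * u (Z \<omega>))"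
      "expectation (\<lambda>\<omega>. X k \<omega> * G (Z \<omega>)) = expectation (\<lambda>\<omega>. Y k \<omega> * u (Z \<omega>))"
      unfolding Y_def Z
      using centered_density_rv.stein_identity_indep[OF X[OF k] _ _ G u B] by blast+
  qed
  have uint: "integrable M (\<lambda>\<omega>. u (Z \<omega>))"
    by (rule integrable_const_bound[where B=B]) (auto simp: B)
  have Sint: "integrable M S" "integrable M (\<lambda>\<omega>. S \<omega> * u (Z \<omega>))"
    unfolding S_def sum_distrib_right by (intro Bochner_Integration.integrable_sum Yint id; assumption)+
  have ZG: "integrable M (\<lambda>\<omega>. Z \<omega> * G (Z \<omega>))"
  proof -
    have "integrable M (\<lambda>\<omega>. \<Sum>k\<in>K. X k \<omega> * G (Z \<omega>))"
      by (intro Bochner_Integration.integrable_sum id)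
    then show ?thesis unfolding sum_distrib_right[symmetric] Z_def .
  qed
  have "expectation (\<lambda>\<omega>. Z \<omega> * G (Z \<omega>)) = expectation (\<lambda>\<omega>. \<Sum>k\<in>K. X k \<omega> * G (Z \<omega>))"
    unfolding sum_distrib_right[symmetric] Z_def ..
  also have "\<dots> = (\<Sum>k\<in>K. expectation (\<lambda>\<omega>. Y k \<omega> * u (Z \<omega>)))"
    by (subst Bochner_Integration.integral_sum) (auto simp: id)
  also have "\<dots> = expectation (\<lambda>\<omega>. S \<omega> * u (Z \<omega>))"
    unfolding S_def sum_distrib_right by (subst Bochner_Integration.integral_sum) (auto simp: id)
  finally have "expectation (\<lambda>\<omega>. u (Z \<omega>) - Z \<omega> * G (Z \<omega>)) = expectation (\<lambda>\<omega>. u (Z \<omega>) - S \<omega> * u (Z \<omega>))"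
    using uint ZG Sint by simp
  \<comment> \<open>\<open>1 - S\<close> is split at the mean of \<open>S\<close>: a deterministic
    part, the variance mismatch, and the fluctuation of \<open>S\<close>.\<close>
  also have "\<bar>\<dots>\<bar> \<le> expectation (\<lambda>\<omega>. B * (\<bar>1 - (\<Sum>k\<in>K. m k)\<bar> + \<bar>S \<omega> - (\<Sum>k\<in>K. m k)\<bar>))"
  proof (rule order_trans[OF integral_abs_bound integral_mono])
    fix \<omega>
    have "u (Z \<omega>) - S \<omega> * u (Z \<omega>) = u (Z \<omega>) * (1 - S \<omega>)" by (simp add: algebra_simps)
    also have "\<bar>\<dots>\<bar> \<le> B * (\<bar>1 - (\<Sum>k\<in>K. m k)\<bar> + \<bar>S \<omega> - (\<Sum>k\<in>K. m k)\<bar>)"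
      unfolding abs_mult using B[of "Z \<omega>"] by (intro mult_mono) auto
    finally show "\<bar>u (Z \<omega>) - S \<omega> * u (Z \<omega>)\<bar> \<le> B * (\<bar>1 - (\<Sum>k\<in>K. m k)\<bar> + \<bar>S \<omega> - (\<Sum>k\<in>K. m k)\<bar>)" .
  qed (use uint Sint in auto)
  also have "\<dots> = B * (\<bar>1 - (\<Sum>k\<in>K. m k)\<bar> + expectation (\<lambda>\<omega>. \<bar>S \<omega> - (\<Sum>k\<in>K. m k)\<bar>))"
    using Sint by (simp add: prob_space)
  finally have main: "\<bar>expectation (\<lambda>\<omega>. u (Z \<omega>) - Z \<omega> * G (Z \<omega>))\<bar> \<le>
     B * (\<bar>1 - (\<Sum>k\<in>K. m k)\<bar> + expectation (\<lambda>\<omega>. \<bar>S \<omega> - (\<Sum>k\<in>K. m k)\<bar>))" .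
  \<comment> \<open>The mean of \<open>S\<close> is also the sum of the \<open>m k\<close>, so the
    deterministic part is exactly \<open>\<bar>1 - E[Z^2]\<bar>\<close>.\<close>
  have EZ: "expectation (\<lambda>\<omega>. (Z \<omega>)\<^sup>2) = (\<Sum>k\<in>K. m k)"
    using indep_sum_square[OF fin indep] X unfolding Z_def m_def
    by (auto simp: centered_density_rv_def centered_density_rv_axioms_def)
  \<comment> \<open>Being functions of the independent \<open>X k\<close>, the centered kernels are
    independent; their second moments are the summands under the root.\<close>
  define C where "C = (\<lambda>k \<omega>. Y k \<omega> - m k)"
  have "indep_vars (\<lambda>_. borel) (\<lambda>k \<omega>. stein_kernel M (X k) (X k \<omega>) - m k) K"
  proof (rule indep_vars_compose2[OF indep])
    fix k assume k: "k \<in> K"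
    have [measurable]: "stein_kernel M (X k) \<in> borel_measurable borel"
      by (rule centered_density_rv.stein_kernel_measurable[OF X[OF k]])
    show "(\<lambda>x. stein_kernel M (X k) x - m k) \<in> borel_measurable borel" by measurable
  qed
  then have C: "indep_vars (\<lambda>_. borel) C K" by (simp add: C_def Y_def)
  have Ysq: "integrable M (\<lambda>\<omega>. (Y k \<omega>)\<^sup>2)" if "k \<in> K" for k using sq[OF that] by (simp add: Y_def)
  have Csq: "(\<lambda>\<omega>. (C k \<omega>)\<^sup>2) = (\<lambda>\<omega>. (Y k \<omega>)\<^sup>2 - 2 * m k * Y k \<omega> + (m k)\<^sup>2)" for k
    by (auto simp: C_def power2_eq_square algebra_simps)
  have C2: "integrable M (\<lambda>\<omega>. (C k \<omega>)\<^sup>2)" "expectation (C k) = 0"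
    "expectation (\<lambda>\<omega>. (C k \<omega>)\<^sup>2) = expectation (\<lambda>\<omega>. (Y k \<omega>)\<^sup>2) - (m k)\<^sup>2" if "k \<in> K" for k
    unfolding Csq using Ysq[OF that] Yint[OF that]
    by (auto simp: C_def prob_space power2_eq_square)
  have CS: "(\<lambda>\<omega>. \<Sum>k\<in>K. C k \<omega>) = (\<lambda>\<omega>. S \<omega> - (\<Sum>k\<in>K. m k))"
    by (auto simp: C_def S_def sum_subtractf)
  note sum = indep_sum_square[OF fin C C2(1,2)]
  have "expectation (\<lambda>\<omega>. \<bar>S \<omega> - (\<Sum>k\<in>K. m k)\<bar>) \<le> sqrt (expectation (\<lambda>\<omega>. (S \<omega> - (\<Sum>k\<in>K. m k))\<^sup>2))"
    using sum Sint unfolding CS[THEN fun_cong] by (intro expectation_abs_le_sqrt) auto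
  also have "expectation (\<lambda>\<omega>. (S \<omega> - (\<Sum>k\<in>K. m k))\<^sup>2) = (\<Sum>k\<in>K. expectation (\<lambda>\<omega>. (Y k \<omega>)\<^sup>2) - (m k)\<^sup>2)"
    using sum C2(3) unfolding CS[THEN fun_cong] by simp
  finally have sd: "expectation (\<lambda>\<omega>. \<bar>S \<omega> - (\<Sum>k\<in>K. m k)\<bar>) \<le> sqrt (\<Sum>k\<in>K. expectation (\<lambda>\<omega>. (Y k \<omega>)\<^sup>2) - (m k)\<^sup>2)" .
  have "0 \<le> B" using B[of 0] by simp
  then have "B * (\<bar>1 - (\<Sum>k\<in>K. m k)\<bar> + expectation (\<lambda>\<omega>. \<bar>S \<omega> - (\<Sum>k\<in>K. m k)\<bar>))
    \<le> B * (\<bar>1 - (\<Sum>k\<in>K. m k)\<bar> + sqrt (\<Sum>k\<in>K. expectation (\<lambda>\<omega>. (Y k \<omega>)\<^sup>2) - (m k)\<^sup>2))"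
    using sd by (intro mult_left_mono add_left_mono)
  with main show ?thesis unfolding EZ by (simp add: Y_def m_def)
qed

section \<open>Total variation from continuous test functions\<close>

text \<open>The functions \<open>min 1 (n * infdist x (- U))\<close> are continuous with values in
  \<open>[0, 1]\<close> and converge pointwise to the indicator of \<open>U\<close>; dominated
  convergence does the rest.\<close>

lemma open_measure_diff_le:
  fixes \<mu> \<nu> :: "'b::metric_space measure"
  assumes "prob_space \<mu>" "prob_space \<nu>" and sets: "sets \<mu> = sets borel" "sets \<nu> = sets borel"
    and bound: "\<And>h::'b \<Rightarrow> real. continuous_on UNIV h \<Longrightarrow> (\<And>x. 0 \<le> h x) \<Longrightarrow> (\<And>x. h x \<le> 1)
      \<Longrightarrow> \<bar>(LINT x|\<mu>. h x) - (LINT x|\<nu>. h x)\<bar> \<le> K"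
    and U: "open U"
  shows "\<bar>measure \<mu> U - measure \<nu> U\<bar> \<le> K"
proof (cases "U = UNIV")
  \<comment> \<open>Here the approximants fail, since \<open>infdist\<close> to the empty set is 0;
    but both masses are 1, and the test function 0 gives \<open>0 \<le> K\<close>.\<close>
  case True
  have "space \<mu> = UNIV" "space \<nu> = UNIV" using sets[THEN sets_eq_imp_space_eq] by auto
  then have "measure \<mu> U = 1" "measure \<nu> U = 1"
    using prob_space.prob_space[OF assms(1)] prob_space.prob_space[OF assms(2)] True by auto
  then show ?thesis using bound[of "\<lambda>_. 0"] by simp
next
  case False
  define h where "h = (\<lambda>(n::nat) x. min 1 (real n * infdist x (- U)))"
  have h: "continuous_on UNIV (h n)" "0 \<le> h n x" "h n x \<le> 1" for n x
    unfolding h_def by (auto intro!: continuous_intros simp: infdist_nonneg)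
  have lim: "(\<lambda>n. h n x) \<longlonglongrightarrow> indicator U x" for x
  proof (cases "x \<in> U")
    case True
    have "infdist x (- U) \<noteq> 0"
      using True False U in_closed_iff_infdist_zero[of "- U" x] by auto
    then have pos: "infdist x (- U) > 0" using infdist_nonneg[of x "- U"] by simp
    then obtain N where N: "1 < real N * infdist x (- U)" using reals_Archimedean3 by blast
    have "eventually (\<lambda>n. h n x = 1) sequentially"
      using eventually_ge_at_top[of N]
    proof eventually_elim
      case (elim n)
      then have "real N * infdist x (- U) \<le> real n * infdist x (- U)"
        using pos by (intro mult_right_mono) auto
      with N show ?case by (simp add: h_def)
    qed
    then show ?thesis using True by (auto intro: tendsto_eventually)
  qed (simp add: h_def)
  have conv: "(\<lambda>n. LINT x|\<rho>. h n x) \<longlonglongrightarrow> measure \<rho> U"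
    if "prob_space \<rho>" "sets \<rho> = sets borel" for \<rho>
  proof -
    interpret prob_space \<rho> by fact
    have [measurable_cong]: "sets \<rho> = sets borel" by fact
    have [measurable]: "h n \<in> borel_measurable borel" for n
      using h(1) by (rule borel_measurable_continuous_onI)
    have [measurable]: "U \<in> sets borel" using U by simp
    have "(\<lambda>n. LINT x|\<rho>. h n x) \<longlonglongrightarrow> (LINT x|\<rho>. indicator U x)"
    proof (rule integral_dominated_convergence[where w="\<lambda>_. 1"])
      show "AE x in \<rho>. (\<lambda>n. h n x) \<longlonglongrightarrow> indicator U x" using lim by (intro AE_I2)
      show "AE x in \<rho>. norm (h n x) \<le> 1" for n using h[of n] by (intro AE_I2) simp
    qed auto
    moreover have "U \<inter> space \<rho> = U" using sets_eq_imp_space_eq[OF that(2)] by simp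
    ultimately show ?thesis by simp
  qed
  have "(\<lambda>n. \<bar>(LINT x|\<mu>. h n x) - (LINT x|\<nu>. h n x)\<bar>) \<longlonglongrightarrow> \<bar>measure \<mu> U - measure \<nu> U\<bar>"
    by (intro tendsto_intros conv assms)
  then show ?thesis
  proof (rule LIMSEQ_le_const2)
    show "\<exists>N. \<forall>n\<ge>N. \<bar>(LINT x|\<mu>. h n x) - (LINT x|\<nu>. h n x)\<bar> \<le> K"
      by (intro exI allI impI bound h)
  qed
qed

lemma outer_approximation:
  fixes \<mu> :: "'b::{second_countable_topology, complete_space} measure"
  assumes "finite_measure \<mu>" "sets \<mu> = sets borel" "A \<in> sets borel" "e > 0"
  obtains U where "open U" "A \<subseteq> U" "measure \<mu> U < measure \<mu> A + e"
proof -
  interpret finite_measure \<mu> by fact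
  have "emeasure \<mu> A < ennreal (measure \<mu> A + e)"
    using \<open>e > 0\<close> by (simp add: emeasure_eq_measure ennreal_less_iff)
  then have "(INF U \<in> {U. A \<subseteq> U \<and> open U}. emeasure \<mu> U) < ennreal (measure \<mu> A + e)"
    using outer_regular[of \<mu> A] assms by (simp add: emeasure_finite)
  then obtain U where "A \<subseteq> U" "open U" "emeasure \<mu> U < ennreal (measure \<mu> A + e)"
    by (auto simp: INF_less_iff)
  then show ?thesis using that by (simp add: emeasure_eq_measure ennreal_less_iff)
qed

text \<open>One open set must serve both measures: the intersection of the two outer approximations
  does. Its excess mass over \<open>A\<close> lies between 0 and \<open>e\<close> for each measure,
  so the difference changes by at most \<open>e\<close>.\<close>

lemma borel_measure_diff_le:
  fixes \<mu> \<nu> :: "'b::{second_countable_topology, complete_space} measure"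
  assumes "prob_space \<mu>" "prob_space \<nu>" and sets: "sets \<mu> = sets borel" "sets \<nu> = sets borel"
    and bound: "\<And>h::'b \<Rightarrow> real. continuous_on UNIV h \<Longrightarrow> (\<And>x. 0 \<le> h x) \<Longrightarrow> (\<And>x. h x \<le> 1)
      \<Longrightarrow> \<bar>(LINT x|\<mu>. h x) - (LINT x|\<nu>. h x)\<bar> \<le> K"
    and A: "A \<in> sets borel"
  shows "\<bar>measure \<mu> A - measure \<nu> A\<bar> \<le> K"
proof (rule field_le_epsilon)
  fix e :: real assume e: "e > 0"
  interpret \<mu>: prob_space \<mu> by fact
  interpret \<nu>: prob_space \<nu> by fact
  obtain U where U: "open U" "A \<subseteq> U" "measure \<mu> U < measure \<mu> A + e"
    using outer_approximation[OF \<mu>.finite_measure_axioms sets(1) A e] .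
  obtain V where V: "open V" "A \<subseteq> V" "measure \<nu> V < measure \<nu> A + e"
    using outer_approximation[OF \<nu>.finite_measure_axioms sets(2) A e] .
  have "\<bar>measure \<mu> (U \<inter> V) - measure \<nu> (U \<inter> V)\<bar> \<le> K"
    using U V by (intro open_measure_diff_le assms) auto
  moreover have "measure \<mu> A \<le> measure \<mu> (U \<inter> V)" "measure \<mu> (U \<inter> V) \<le> measure \<mu> U"
    using U V sets by (auto intro!: \<mu>.finite_measure_mono)
  moreover have "measure \<nu> A \<le> measure \<nu> (U \<inter> V)" "measure \<nu> (U \<inter> V) \<le> measure \<nu> V"
    using U V sets by (auto intro!: \<nu>.finite_measure_mono)
  ultimately show "\<bar>measure \<mu> A - measure \<nu> A\<bar> \<le> K + e" using U(3) V(3) by linarith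
qed

section \<open>Normal approximation\<close>

lemma ereal_sqrt_PInf: "ereal_sqrt \<infinity> = \<infinity>"
  by (simp only: ereal_sqrt_def infinity_ereal_def ereal.case)

lemma second_moment_finite:
  assumes "Y \<in> borel_measurable M" "second_moment M Y \<noteq> \<infinity>"
  shows "integrable M (\<lambda>\<omega>. (Y \<omega>)\<^sup>2)" "second_moment M Y = ereal (LINT \<omega>|M. (Y \<omega>)\<^sup>2)"
proof -
  have "(\<integral>\<^sup>+ \<omega>. ennreal ((Y \<omega>)\<^sup>2) \<partial>M) \<noteq> \<infinity>"
    using assms(2) by (auto simp: second_moment_def)
  then show i: "integrable M (\<lambda>\<omega>. (Y \<omega>)\<^sup>2)"
    using assms(1) by (intro integrableI_nonneg) (auto simp: top.not_eq_extremum)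
  show "second_moment M Y = ereal (LINT \<omega>|M. (Y \<omega>)\<^sup>2)"
    unfolding second_moment_def by (subst nn_integral_eq_integral[OF i]) auto
qed

theorem proposition4p4:
  fixes M :: "'a measure" and X :: "nat \<Rightarrow> 'a \<Rightarrow> real"
    and P :: "'b measure" and \<N> :: "'b \<Rightarrow> real"
    and n :: nat
  assumes "prob_space M"
    and "prob_space.indep_vars M (\<lambda>_. borel) X {1..}"
    and "\<And>k. k \<ge> 1 \<Longrightarrow> integrable M (\<lambda>\<omega>. (X k \<omega>)\<^sup>2)"
    and "\<And>k. k \<ge> 1 \<Longrightarrow> integrable M (X k)"
    and "\<And>k. k \<ge> 1 \<Longrightarrow> (LINT \<omega>|M. X k \<omega>) = 0"
    and "\<And>k. k \<ge> 1 \<Longrightarrow> nonvanishing_continuous_density M (X k)"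
    and "prob_space P"
    and "distributed P lborel \<N> (\<lambda>x. ennreal (std_normal_density x))"
    and "n \<ge> 1"
  shows "let Z = (\<lambda>\<omega>. \<Sum>k=1..n. X k \<omega>);
             R = ereal_sqrt (\<Sum>k=1..n.
                   second_moment M (\<lambda>\<omega>. stein_kernel M (X k) (X k \<omega>))
                   - ereal ((LINT \<omega>|M. (X k \<omega>)\<^sup>2)\<^sup>2))
         in wasserstein_dist M Z P \<N> \<le> ereal \<bar>1 - (LINT \<omega>|M. (Z \<omega>)\<^sup>2)\<bar> + R
          \<and> total_variation_dist M Z P \<N>
              \<le> 2 * ereal \<bar>1 - (LINT \<omega>|M. (Z \<omega>)\<^sup>2)\<bar> + 2 * R"
proof -
  interpret M: prob_space M by fact
  interpret P: prob_space P by fact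
  define Z where "Z = (\<lambda>\<omega>. \<Sum>k=1..n. X k \<omega>)"
  define Y where "Y = (\<lambda>k \<omega>. stein_kernel M (X k) (X k \<omega>))"
  define q where "q = (\<lambda>k. second_moment M (Y k) - ereal ((LINT \<omega>|M. (X k \<omega>)\<^sup>2)\<^sup>2))"
  define m where "m = \<bar>1 - (LINT \<omega>|M. (Z \<omega>)\<^sup>2)\<bar>"
  define R where "R = ereal_sqrt (\<Sum>k=1..n. q k)"
  have X: "centered_density_rv M (X k)" if "k \<in> {1..n}" for k
  proof -
    have "k \<ge> 1" using that by simp
    then show ?thesis
      by (intro centered_density_rv.intro continuous_density_rv.intro assms(1)
          continuous_density_rv_axioms.intro centered_density_rv_axioms.intro assms(3,5,6))
  qed
  have Xm[measurable]: "X k \<in> borel_measurable M" if "k \<in> {1..n}" for k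
    using assms(4)[of k] that by simp
  have Zint: "integrable M Z"
    unfolding Z_def using assms(4) by (intro Bochner_Integration.integrable_sum) auto
  have [measurable]: "Z \<in> borel_measurable M" using Zint by auto
  have N: "\<N> \<in> borel_measurable P" using assms(8) by (auto dest: distributed_measurable)
  have Nexp: "(LINT \<omega>|P. h (\<N> \<omega>)) = (LINT t|lborel. h t * \<psi> t)" if "h \<in> borel_measurable borel" for h :: "real \<Rightarrow> real"
    using distributed_integral[OF assms(8), of h] that by (simp add: mult.commute)
  have "wasserstein_dist M Z P \<N> \<le> ereal m + R
      \<and> total_variation_dist M Z P \<N> \<le> 2 * ereal m + 2 * R"
  proof (cases "\<exists>k\<in>{1..n}. second_moment M (Y k) = \<infinity>")
    \<comment> \<open>An infinite second moment makes the right-hand sides infinite: subtracting a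
      finite square leaves \<open>\<infinity>\<close>, which then dominates the sum.\<close>
    case True
    then obtain k where k: "k \<in> {1..n}" "second_moment M (Y k) = \<infinity>" by blast
    then have "q k = \<infinity>" by (simp add: q_def)
    with k(1) have "(\<Sum>k=1..n. q k) = \<infinity>" unfolding sum_Pinfty by blast
    then have "R = \<infinity>" by (simp add: R_def ereal_sqrt_PInf)
    then show ?thesis by simp
  next
    case False
    have Ym: "Y k \<in> borel_measurable M" if "k \<in> {1..n}" for k
    proof -
      have [measurable]: "stein_kernel M (X k) \<in> borel_measurable borel"
        by (rule centered_density_rv.stein_kernel_measurable[OF X[OF that]])
      show ?thesis unfolding Y_def using Xm[OF that] by measurable
    qed
    have Ysq: "integrable M (\<lambda>\<omega>. (Y k \<omega>)\<^sup>2)"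
       "second_moment M (Y k) = ereal (LINT \<omega>|M. (Y k \<omega>)\<^sup>2)" if "k \<in> {1..n}" for k
      using second_moment_finite[OF Ym[OF that]] False that by blast+
    define r where "r = sqrt (\<Sum>k=1..n. (LINT \<omega>|M. (Y k \<omega>)\<^sup>2) - (LINT \<omega>|M. (X k \<omega>)\<^sup>2)\<^sup>2)"
    have "(\<Sum>k=1..n. q k) = (\<Sum>k=1..n. ereal ((LINT \<omega>|M. (Y k \<omega>)\<^sup>2) - (LINT \<omega>|M. (X k \<omega>)\<^sup>2)\<^sup>2))"
      by (intro sum.cong refl) (simp add: q_def Ysq)
    then have R: "R = ereal r" by (simp add: R_def r_def ereal_sqrt_def)
    \<comment> \<open>Both distances reduce to this estimate. By the Stein equation
      \<open>u (Z) - Z * G (Z)\<close> is \<open>h (Z)\<close> minus the normal mean of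
      \<open>h\<close>, so \<open>stein_bound\<close> applies; only \<open>B\<close> differs, 1 for
      Lipschitz and 2 for bounded \<open>h\<close>.\<close>
    have key: "\<bar>(LINT \<omega>|M. h (Z \<omega>)) - (LINT \<omega>|P. h (\<N> \<omega>))\<bar> \<le> B * (m + r)"
      if h: "h \<in> borel_measurable borel" "integrable M (\<lambda>\<omega>. h (Z \<omega>))"
        and G: "\<And>x. DERIV G x :> u x" "continuous_on UNIV u" "\<And>x. \<bar>u x\<bar> \<le> B"
          "\<And>x. u x = x * G x + (h x - (LINT t|lborel. h t * \<psi> t))" for h G u B
    proof -
      have "M.indep_vars (\<lambda>_. borel) X {1..n}"
        by (rule M.indep_vars_subset[OF assms(2)]) auto
      from M.stein_bound[OF _ this X _ G(1-3), folded Y_def Z_def] Ysq(1)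
      have "\<bar>LINT \<omega>|M. u (Z \<omega>) - Z \<omega> * G (Z \<omega>)\<bar> \<le> B * (m + r)"
        by (simp add: m_def r_def Y_def Z_def)
      moreover have "(LINT \<omega>|M. u (Z \<omega>) - Z \<omega> * G (Z \<omega>)) = (LINT \<omega>|M. h (Z \<omega>)) - (LINT t|lborel. h t * \<psi> t)"
        unfolding G(4) using h(2) by (simp add: M.prob_space)
      ultimately show ?thesis by (simp add: Nexp[OF h(1)])
    qed
    have "wasserstein_dist M Z P \<N> \<le> ereal (1 * (m + r))"
      unfolding wasserstein_dist_def
    proof (intro SUP_least, unfold ereal_less_eq, drule CollectD)
      fix h :: "real \<Rightarrow> real" assume h: "1-lipschitz_on UNIV h"
      then have [measurable]: "h \<in> borel_measurable borel"
        by (intro borel_measurable_continuous_onI lipschitz_on_continuous_on)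
      obtain G u where G: "\<And>x. DERIV G x :> u x" "continuous_on UNIV u" "\<And>x. \<bar>u x\<bar> \<le> 1"
          "\<And>x. u x = x * G x + (h x - (LINT t|lborel. h t * \<psi> t))"
        using stein_solution_lipschitz[OF h] by blast
      have "integrable M (\<lambda>\<omega>. h (Z \<omega>))"
      proof (rule Bochner_Integration.integrable_bound)
        show "integrable M (\<lambda>\<omega>. \<bar>Z \<omega>\<bar> + \<bar>h 0\<bar>)" using Zint by simp
        have "\<bar>h z\<bar> \<le> \<bar>\<bar>z\<bar> + \<bar>h 0\<bar>\<bar>" for z
          using lipschitz_onD[OF h, of z 0] by (simp add: dist_real_def)
        then show "AE \<omega> in M. norm (h (Z \<omega>)) \<le> norm (\<bar>Z \<omega>\<bar> + \<bar>h 0\<bar>)" by simp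
      qed simp
      then show "\<bar>(LINT \<omega>|M. h (Z \<omega>)) - (LINT \<omega>|P. h (\<N> \<omega>))\<bar> \<le> 1 * (m + r)"
        by (intro key[OF _ _ G]) simp
    qed
    moreover have "total_variation_dist M Z P \<N> \<le> ereal (2 * (m + r))"
      unfolding total_variation_dist_def
    proof (intro SUP_least, unfold ereal_less_eq)
      fix A :: "real set" assume A: "A \<in> sets borel"
      have "\<bar>measure (distr M borel Z) A - measure (distr P borel \<N>) A\<bar> \<le> 2 * (m + r)"
      proof (rule borel_measure_diff_le[OF _ _ _ _ _ A])
        fix h :: "real \<Rightarrow> real" assume h: "continuous_on UNIV h" "\<And>x. 0 \<le> h x" "\<And>x. h x \<le> 1"
        have [measurable]: "h \<in> borel_measurable borel"
          using h(1) by (rule borel_measurable_continuous_onI)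
        obtain G u where G: "\<And>x. DERIV G x :> u x" "continuous_on UNIV u" "\<And>x. \<bar>u x\<bar> \<le> 2"
            "\<And>x. u x = x * G x + (h x - (LINT t|lborel. h t * \<psi> t))"
          using stein_solution_bounded[OF h] by blast
        have "integrable M (\<lambda>\<omega>. h (Z \<omega>))"
          by (rule M.integrable_const_bound[where B=1]) (use h in auto)
        then have "\<bar>(LINT \<omega>|M. h (Z \<omega>)) - (LINT \<omega>|P. h (\<N> \<omega>))\<bar> \<le> 2 * (m + r)"
          by (intro key[OF _ _ G]) simp
        then show "\<bar>(LINT x|distr M borel Z. h x) - (LINT x|distr P borel \<N>. h x)\<bar> \<le> 2 * (m + r)"
          using N by (simp add: integral_distr)
      qed (use N in \<open>auto intro: M.prob_space_distr P.prob_space_distr\<close>)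
      moreover have "Z -` A \<inter> space M = {\<omega> \<in> space M. Z \<omega> \<in> A}" "\<N> -` A \<inter> space P = {\<omega> \<in> space P. \<N> \<omega> \<in> A}"
        by auto
      ultimately show "\<bar>measure M {\<omega> \<in> space M. Z \<omega> \<in> A} - measure P {\<omega> \<in> space P. \<N> \<omega> \<in> A}\<bar> \<le> 2 * (m + r)"
        using A N by (simp add: measure_distr)
    qed
    ultimately show ?thesis by (simp add: R distrib_left)
  qed
  then show ?thesis unfolding Let_def Z_def[symmetric] m_def R_def q_def Y_def .
qed

end
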